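(* Let $q\ge 3$ and $D\geq 1$ be integers. Let $\mathbf P(D)$ be the set of all pairs $(p,k)$ of integers with $0\leq p\leq D$ and $0\leq k\leq \lfloor p/2\rfloor$, and let $\mathbf M(D)$ be the set of all isomorphism classes of irreducible $\mathcal T(D)$-modules. Then the map $\mathbf P(D)\to\mathbf M(D)$ sending $(p,k)$ to the isomorphism class of $L_{p,k}(D)$ is a bijection.
   Context: Fix an integer $q\geq 3$ and let $X=\{0,1,\dots,q-1\}$. For $D\geq1$, the Hamming graph $H(D,q)$ has vertex set $X^D$, with $x,y$ adjacent iff they differ in exactly one coordinate; $\partial(x,y)$ is the number of coordinates in which $x,y$ differ. $\mathbf A(D)$ is its adjacency matrix and $\mathbf A^*(D)$ the diagonal matrix with $\mathbf A^*(D)_{yy}=D(q-1)-q\,\partial((0,\dots,0),y)$. $\mathcal T(D)$ is the subalgebra of $\mathrm{Mat}_{X^D}(\mathbb C)$ generated by $\mathbf A(D),\mathbf A^*(D)$. For $(p,k)\in\mathbf P(D)$, set $\alpha_i=(q-2)(i+k)+p-D$, $\beta_i=i+1$, $\gamma_i=(q-1)(p-i-2k+1)$, $\theta_i=q(p-i-k)-D$; $L_{p,k}(D)$ denotes a $(p-2k+1)$-dimensional irreducible $\mathcal T(D)$-module having a basis with respect to which $\mathbf A(D)$ acts by the tridiagonal matrix with diagonal $(\alpha_0,\dots,\alpha_{p-2k})$, entries $(i+1,i)$ equal to $\beta_i$ ($0\le i\le p-2k-1$) and entries $(i-1,i)$ equal to $\gamma_i$ ($1\le i\le p-2k$), and $\mathbf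 A^*(D)$ acts by $\mathrm{diag}(\theta_0,\dots,\theta_{p-2k})$ (such a module exists and is determined up to isomorphism). *)

theory Defs
  imports Complex_Main "HOL-Library.FuncSet" "HOL-Algebra.Module" "HOL-Algebra.Generated_Rings"
begin

section \<open>Matrix rings over the complex numbers\<close>

text \<open>
  A matrix with rows and columns indexed by a finite set \<open>S\<close> is a function of two arguments that
  vanishes outside \<open>S \<times> S\<close>.
\<close>

type_synonym 'i cmat = "'i \<Rightarrow> 'i \<Rightarrow> complex"

definition diag_cmat :: "'i set \<Rightarrow> ('i \<Rightarrow> complex) \<Rightarrow> 'i cmat" where
  "diag_cmat S d = (\<lambda>x y. if x \<in> S \<and> x = y then d x else 0)"

definition scalar_cmat :: "'i set \<Rightarrow> complex \<Rightarrow> 'i cmat" where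
  "scalar_cmat S c = diag_cmat S (\<lambda>_. c)"

definition cmat_ring :: "'i set \<Rightarrow> 'i cmat ring" where
  "cmat_ring S =
    \<lparr>carrier = {M. \<forall>x y. x \<notin> S \<or> y \<notin> S \<longrightarrow> M x y = 0},
     monoid.mult = (\<lambda>M N x y. \<Sum>z\<in>S. M x z * N z y),
     one = scalar_cmat S 1,
     zero = (\<lambda>x y. 0),
     add = (\<lambda>M N x y. M x y + N x y)\<rparr>"

text \<open>
  The unital complex subalgebra generated by \<open>G\<close>, as a ring: it is the smallest subring containing
  \<open>G\<close> and all scalar matrices.
\<close>

definition generated_algebra :: "'i set \<Rightarrow> 'i cmat set \<Rightarrow> 'i cmat ring" where
  "generated_algebra S G =
    (cmat_ring S)\<lparr>carrier := generate_ring (cmat_ring S) (G \<union> range (scalar_cmat S))\<rparr>"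


section \<open>Unital left modules over a not necessarily commutative ring\<close>

text \<open>
  The library's locale \<open>module\<close> demands a commutative ring of scalars; its record type and its
  locale \<open>submodule\<close> do not, and are reused here.  The fields \<open>mult\<close> and \<open>one\<close> of the record
  play no role.
\<close>

locale left_module = R?: ring R + M?: abelian_group M
  for R :: "('a, 'd) ring_scheme" (structure) and M :: "('a, 'b, 'c) module_scheme" (structure) +
  assumes smult_closed:
      "\<lbrakk>a \<in> carrier R; x \<in> carrier M\<rbrakk> \<Longrightarrow> a \<odot>\<^bsub>M\<^esub> x \<in> carrier M"
    and smult_l_distr:
      "\<lbrakk>a \<in> carrier R; b \<in> carrier R; x \<in> carrier M\<rbrakk> \<Longrightarrow>
        (a \<oplus>\<^bsub>R\<^esub> b) \<odot>\<^bsub>M\<^esub> x = a \<odot>\<^bsub>M\<^esub> x \<oplus>\<^bsub>M\<^esub> b \<odot>\<^bsub>M\<^esub> x"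
    and smult_r_distr:
      "\<lbrakk>a \<in> carrier R; x \<in> carrier M; y \<in> carrier M\<rbrakk> \<Longrightarrow>
        a \<odot>\<^bsub>M\<^esub> (x \<oplus>\<^bsub>M\<^esub> y) = a \<odot>\<^bsub>M\<^esub> x \<oplus>\<^bsub>M\<^esub> a \<odot>\<^bsub>M\<^esub> y"
    and smult_assoc:
      "\<lbrakk>a \<in> carrier R; b \<in> carrier R; x \<in> carrier M\<rbrakk> \<Longrightarrow>
        (a \<otimes>\<^bsub>R\<^esub> b) \<odot>\<^bsub>M\<^esub> x = a \<odot>\<^bsub>M\<^esub> (b \<odot>\<^bsub>M\<^esub> x)"
    and smult_one:
      "x \<in> carrier M \<Longrightarrow> \<one>\<^bsub>R\<^esub> \<odot>\<^bsub>M\<^esub> x = x"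

definition irreducible_module :: "'a ring \<Rightarrow> ('a, 'v) module \<Rightarrow> bool" where
  "irreducible_module R M \<longleftrightarrow>
     left_module R M \<and> carrier M \<noteq> {\<zero>\<^bsub>M\<^esub>} \<and>
     (\<forall>H. submodule H R M \<longrightarrow> H = {\<zero>\<^bsub>M\<^esub>} \<or> H = carrier M)"

definition isomorphic_modules :: "'a ring \<Rightarrow> ('a, 'v) module \<Rightarrow> ('a, 'w) module \<Rightarrow> bool" where
  "isomorphic_modules R M N \<longleftrightarrow>
     (\<exists>h. bij_betw h (carrier M) (carrier N) \<and>
        (\<forall>x\<in>carrier M. \<forall>y\<in>carrier M. h (x \<oplus>\<^bsub>M\<^esub> y) = h x \<oplus>\<^bsub>N\<^esub> h y) \<and>
        (\<forall>a\<in>carrier R. \<forall>x\<in>carrier M. h (a \<odot>\<^bsub>M\<^esub> x) = a \<odot>\<^bsub>N\<^esub> h x))"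

text \<open>Isomorphism classes are taken among the modules whose elements live in one type \<open>'v\<close>.\<close>

definition iso_class :: "'a ring \<Rightarrow> ('a, 'v) module \<Rightarrow> ('a, 'v) module set" where
  "iso_class R M = {N. left_module R N \<and> isomorphic_modules R M N}"

definition irreducible_classes :: "'a ring \<Rightarrow> ('a, 'v) module set set" where
  "irreducible_classes R = iso_class R ` {M. irreducible_module R M}"


section \<open>Bases of modules over a complex matrix algebra\<close>

text \<open>
  A module over an algebra of \<open>S \<times> S\<close>-matrices that contains the scalar matrices is a complex vector
  space, where \<open>c\<close> acts as the scalar matrix \<open>c I\<close>.
\<close>

definition cscale :: "'i set \<Rightarrow> ('i cmat, 'v) module \<Rightarrow> complex \<Rightarrow> 'v \<Rightarrow> 'v" where
  "cscale S V c x = scalar_cmat S c \<odot>\<^bsub>V\<^esub> x"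

definition is_basis :: "'i set \<Rightarrow> ('i cmat, 'v) module \<Rightarrow> nat \<Rightarrow> (nat \<Rightarrow> 'v) \<Rightarrow> bool" where
  "is_basis S V n v \<longleftrightarrow>
     v \<in> {..<n} \<rightarrow> carrier V \<and>
     (\<forall>x\<in>carrier V. \<exists>!c. c \<in> {..<n} \<rightarrow>\<^sub>E (UNIV :: complex set) \<and>
        x = (\<Oplus>\<^bsub>V\<^esub>i\<in>{..<n}. cscale S V (c i) (v i)))"

text \<open>
  Column convention: \<open>a\<close> sends the basis vector \<open>v j\<close> to the combination with the coefficients
  \<open>B i j\<close>, so that \<open>B i j\<close> is the entry in row \<open>i\<close> and column \<open>j\<close>.
\<close>

definition acts_by ::
  "'i set \<Rightarrow> ('i cmat, 'v) module \<Rightarrow> nat \<Rightarrow> (nat \<Rightarrow> 'v) \<Rightarrow> 'i cmat \<Rightarrow> (nat \<Rightarrow> nat \<Rightarrow> complex) \<Rightarrow> bool"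
  where
  "acts_by S V n v a B \<longleftrightarrow>
     (\<forall>j<n. a \<odot>\<^bsub>V\<^esub> v j = (\<Oplus>\<^bsub>V\<^esub>i\<in>{..<n}. cscale S V (B i j) (v i)))"


section \<open>The Hamming graph and its Terwilliger algebra\<close>

text \<open>Vertices are the extensional functions from \<open>{..<D}\<close> to \<open>{..<q}\<close>; arguments are \<open>q\<close>, \<open>D\<close>.\<close>

definition hvertices :: "nat \<Rightarrow> nat \<Rightarrow> (nat \<Rightarrow> nat) set" where
  "hvertices q D = {..<D} \<rightarrow>\<^sub>E {..<q}"

definition hdist :: "nat \<Rightarrow> (nat \<Rightarrow> nat) \<Rightarrow> (nat \<Rightarrow> nat) \<Rightarrow> nat" where
  "hdist D x y = card {i. i < D \<and> x i \<noteq> y i}"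

definition hadjacent :: "nat \<Rightarrow> nat \<Rightarrow> (nat \<Rightarrow> nat) \<Rightarrow> (nat \<Rightarrow> nat) \<Rightarrow> bool" where
  "hadjacent q D x y \<longleftrightarrow> x \<in> hvertices q D \<and> y \<in> hvertices q D \<and> hdist D x y = 1"

definition hzero :: "nat \<Rightarrow> nat \<Rightarrow> nat" where
  "hzero D = (\<lambda>i\<in>{..<D}. 0)"

definition adj_mat :: "nat \<Rightarrow> nat \<Rightarrow> (nat \<Rightarrow> nat) cmat" where
  "adj_mat q D = (\<lambda>x y. if hadjacent q D x y then 1 else 0)"

definition dual_adj_mat :: "nat \<Rightarrow> nat \<Rightarrow> (nat \<Rightarrow> nat) cmat" where
  "dual_adj_mat q D = diag_cmat (hvertices q D)
     (\<lambda>y. of_nat D * (of_nat q - 1) - of_nat q * of_nat (hdist D (hzero D) y))"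

definition terwilliger_algebra :: "nat \<Rightarrow> nat \<Rightarrow> (nat \<Rightarrow> nat) cmat ring" where
  "terwilliger_algebra q D =
     generated_algebra (hvertices q D) {adj_mat q D, dual_adj_mat q D}"


section \<open>The modules \<open>L_{p,k}(D)\<close>\<close>

type_synonym 'v tmodule = "((nat \<Rightarrow> nat) cmat, 'v) module"

definition index_pairs :: "nat \<Rightarrow> (nat \<times> nat) set" where
  "index_pairs D = {(p, k). p \<le> D \<and> k \<le> p div 2}"

definition L_alpha :: "nat \<Rightarrow> nat \<Rightarrow> nat \<Rightarrow> nat \<Rightarrow> nat \<Rightarrow> complex" where
  "L_alpha q D p k i = (of_nat q - 2) * (of_nat i + of_nat k) + of_nat p - of_nat D"

definition L_beta :: "nat \<Rightarrow> complex" where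
  "L_beta i = of_nat i + 1"

definition L_gamma :: "nat \<Rightarrow> nat \<Rightarrow> nat \<Rightarrow> nat \<Rightarrow> complex" where
  "L_gamma q p k i = (of_nat q - 1) * (of_nat p - of_nat i - 2 * of_nat k + 1)"

definition L_theta :: "nat \<Rightarrow> nat \<Rightarrow> nat \<Rightarrow> nat \<Rightarrow> nat \<Rightarrow> complex" where
  "L_theta q D p k i = of_nat q * (of_nat p - of_nat i - of_nat k) - of_nat D"

definition L_tridiag :: "nat \<Rightarrow> nat \<Rightarrow> nat \<Rightarrow> nat \<Rightarrow> nat \<Rightarrow> nat \<Rightarrow> complex" where
  "L_tridiag q D p k = (\<lambda>i j.
     if i = j then L_alpha q D p k j
     else if i = j + 1 then L_beta j
     else if i + 1 = j then L_gamma q p k j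
     else 0)"

definition L_diag :: "nat \<Rightarrow> nat \<Rightarrow> nat \<Rightarrow> nat \<Rightarrow> nat \<Rightarrow> nat \<Rightarrow> complex" where
  "L_diag q D p k = (\<lambda>i j. if i = j then L_theta q D p k j else 0)"

definition is_L_module :: "nat \<Rightarrow> nat \<Rightarrow> nat \<Rightarrow> nat \<Rightarrow> 'v tmodule \<Rightarrow> bool" where
  "is_L_module q D p k V \<longleftrightarrow>
     irreducible_module (terwilliger_algebra q D) V \<and>
     (\<exists>v. is_basis (hvertices q D) V (p - 2 * k + 1) v \<and>
        acts_by (hvertices q D) V (p - 2 * k + 1) v (adj_mat q D) (L_tridiag q D p k) \<and>
        acts_by (hvertices q D) V (p - 2 * k + 1) v (dual_adj_mat q D) (L_diag q D p k))"

definition L_module :: "nat \<Rightarrow> nat \<Rightarrow> nat \<Rightarrow> nat \<Rightarrow> 'v tmodule" where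
  "L_module q D p k = (SOME V. is_L_module q D p k V)"

end

theory Submission
  imports Defs
begin

text \<open>
  Let \<open>Z\<close> count the zero coordinates of a vertex, so that \<open>A\<^sup>* = q Z - D\<close>, and let \<open>N\<close> be the sum
  over the sites of the projections of \<open>\<complex>\<^sup>q\<close> onto the span of \<open>e\<^sub>0\<close> and \<open>e\<^sub>1 + \<dots> + e\<^bsub>q-1\<^esub>\<close>.  Split
  \<open>A\<close> according to its effect on the number of zeros as \<open>L + R + F\<close>; then \<open>F = (q-1) N - (q-2) Z - D\<close>, all of
  \<open>Z, N, L, R\<close> are polynomials in \<open>A\<close> and \<open>A\<^sup>*\<close>, and \<open>[Z,L] = L\<close>, \<open>[Z,R] = -R\<close>,
  \<open>[L,R] = (q-1)(2Z - N)\<close> with \<open>N\<close> central: up to \<open>N\<close> this is a representation of \<open>sl\<^sub>2\<close>.  Moreover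
  \<open>Z(Z-1)\<cdots>(Z-D) = 0\<close> and \<open>N(N-1)\<cdots>(N-D) = 0\<close>.

  On an irreducible module \<open>N\<close> is therefore a scalar \<open>p \<le> D\<close>, and an eigenvector \<open>x\<close> of \<open>Z\<close> for its largest
  eigenvalue \<open>z\<close> is killed by \<open>L\<close>.  The vectors \<open>R\<^sup>i x / i!\<close> with \<open>i \<le> n\<close> span the module, where
  \<open>n = 2 z - p\<close>, and since \<open>z - n = p - z\<close> is again an eigenvalue of \<open>Z\<close>, it is a number \<open>k \<ge> 0\<close>; the
  module is \<open>L\<^bsub>p,k\<^esub>\<close>.  Conversely such an \<open>x\<close> exists in the standard module \<open>\<complex>\<^sup>X\<close> for every admissible
  \<open>(p, k)\<close>, namely a tensor product of \<open>k\<close> antisymmetric two-site vectors, \<open>p - 2 k\<close> copies of \<open>e\<^sub>0\<close> and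
  \<open>D - p\<close> copies of \<open>e\<^sub>1 - e\<^sub>2\<close>.  The spectrum of \<open>A\<^sup>*\<close> on \<open>L\<^bsub>p,k\<^esub>\<close> determines \<open>k\<close> and \<open>p - k\<close>.
\<close>

section \<open>Operators acting site by site\<close>

text \<open>Functions are vectors of a tensor power of the \<open>q\<close>-dimensional space, and
  \<open>M\<close> acts on tensor factor \<open>i\<close>. They are taken on all of
  \<open>nat \<Rightarrow> nat\<close>, so that the laws below are pointwise identities; vertices
  enter with \<open>site_op_cong\<close>.\<close>

definition local_op :: "nat \<Rightarrow> (nat \<Rightarrow> nat \<Rightarrow> complex) \<Rightarrow> nat \<Rightarrow> ((nat \<Rightarrow> nat) \<Rightarrow> complex) \<Rightarrow> (nat \<Rightarrow> nat) \<Rightarrow> complex" where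
  "local_op q M i f = (\<lambda>x. \<Sum>a<q. M (x i) a * f (x(i := a)))"

definition site_op :: "nat \<Rightarrow> nat \<Rightarrow> (nat \<Rightarrow> nat \<Rightarrow> complex) \<Rightarrow> ((nat \<Rightarrow> nat) \<Rightarrow> complex) \<Rightarrow> (nat \<Rightarrow> nat) \<Rightarrow> complex" where
  "site_op q D M f = (\<lambda>x. \<Sum>i<D. local_op q M i f x)"

definition loc_mult :: "nat \<Rightarrow> (nat \<Rightarrow> nat \<Rightarrow> complex) \<Rightarrow> (nat \<Rightarrow> nat \<Rightarrow> complex) \<Rightarrow> nat \<Rightarrow> nat \<Rightarrow> complex" where
  "loc_mult q M N = (\<lambda>a c. \<Sum>b<q. M a b * N b c)"

lemma local_op_add: "local_op q M i (\<lambda>x. f x + g x) x = local_op q M i f x + local_op q M i g x"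
  by (simp add: local_op_def sum.distrib algebra_simps)

lemma local_op_diff: "local_op q M i (\<lambda>x. f x - g x) x = local_op q M i f x - local_op q M i g x"
  by (simp add: local_op_def sum_subtractf algebra_simps)

lemma local_op_cmult: "local_op q M i (\<lambda>x. c * f x) x = c * local_op q M i f x"
  by (simp add: local_op_def sum_distrib_left algebra_simps)

lemma local_op_sum: "local_op q M i (\<lambda>x. \<Sum>j\<in>J. f j x) x = (\<Sum>j\<in>J. local_op q M i (f j) x)"
  by (induction J rule: infinite_finite_induct) (simp_all add: local_op_add, simp_all add: local_op_def)

lemma site_op_add: "site_op q D M (\<lambda>x. f x + g x) x = site_op q D M f x + site_op q D M g x"
  by (simp add: site_op_def local_op_add sum.distrib)

lemma site_op_diff: "site_op q D M (\<lambda>x. f x - g x) x = site_op q D M f x - site_op q D M g x"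
  by (simp add: site_op_def local_op_diff sum_subtractf)

lemma site_op_cmult: "site_op q D M (\<lambda>x. c * f x) x = c * site_op q D M f x"
  by (simp add: site_op_def local_op_cmult sum_distrib_left)

lemma site_op_sum: "site_op q D M (\<lambda>x. \<Sum>j\<in>J. f j x) x = (\<Sum>j\<in>J. site_op q D M (f j) x)"
  by (induction J rule: infinite_finite_induct) (simp_all add: site_op_add, simp_all add: site_op_def local_op_def)

lemma local_op_mult: "local_op q M i (local_op q N i f) = local_op q (loc_mult q M N) i f"
proof
  fix x
  have "local_op q M i (local_op q N i f) x = (\<Sum>a<q. \<Sum>b<q. M (x i) a * N a b * f (x(i := b)))"
    by (simp add: local_op_def sum_distrib_left mult.assoc)
  also have "\<dots> = (\<Sum>b<q. \<Sum>a<q. M (x i) a * N a b * f (x(i := b)))"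
    by (rule sum.swap)
  finally show "local_op q M i (local_op q N i f) x = local_op q (loc_mult q M N) i f x"
    by (simp add: local_op_def loc_mult_def sum_distrib_right)
qed

lemma local_op_commute:
  assumes "i \<noteq> j"
  shows "local_op q M i (local_op q N j f) = local_op q N j (local_op q M i f)"
proof
  fix x
  have "local_op q M i (local_op q N j f) x
      = (\<Sum>a<q. \<Sum>b<q. M (x i) a * (N (x j) b * f (x(i := a, j := b))))"
    using assms by (simp add: local_op_def sum_distrib_left)
  also have "\<dots> = (\<Sum>b<q. \<Sum>a<q. M (x i) a * (N (x j) b * f (x(i := a, j := b))))"
    by (rule sum.swap)
  also have "\<dots> = local_op q N j (local_op q M i f) x"
    using assms by (simp add: local_op_def sum_distrib_left fun_upd_twist mult_ac)
  finally show "local_op q M i (local_op q N j f) x = local_op q N j (local_op q M i f) x" .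
qed

text \<open>Operators at distinct sites commute, so only the terms with \<open>i = j\<close> of the
  double sum contribute a commutator. Thus \<open>site_op\<close> respects Lie brackets, and
  commutators can be computed on a single site.\<close>

lemma site_op_commutator:
  assumes "\<And>a b. loc_mult q M N a b = loc_mult q N M a b + K a b"
  shows "site_op q D M (site_op q D N f) x = site_op q D N (site_op q D M f) x + site_op q D K f x"
proof -
  have loc: "local_op q M i (local_op q N j f) x
      = local_op q N j (local_op q M i f) x + (if i = j then local_op q K i f x else 0)" for i j
  proof (cases "i = j")
    case True
    then show ?thesis
      unfolding local_op_mult assms[abs_def]
      by (simp only: local_op_mult)
         (simp add: local_op_def assms sum.distrib distrib_right)
  qed (simp add: local_op_commute)
  have swap: "site_op q D M' (site_op q D N' f) x = (\<Sum>i<D. \<Sum>j<D. local_op q M' i (local_op q N' j f) x)" for M' N'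
    by (simp add: site_op_def local_op_sum)
  have "site_op q D M (site_op q D N f) x
      = (\<Sum>i<D. \<Sum>j<D. local_op q N j (local_op q M i f) x) + (\<Sum>i<D. \<Sum>j<D. if i = j then local_op q K i f x else 0)"
    unfolding swap loc by (simp add: sum.distrib)
  also have "(\<Sum>i<D. \<Sum>j<D. local_op q N j (local_op q M i f) x) = site_op q D N (site_op q D M f) x"
    unfolding swap by (rule sum.swap)
  finally show ?thesis
    by (simp add: site_op_def)
qed

text \<open>\<open>falling_op B m = (B - (m - 1)) \<cdots> (B - 1) B\<close>.\<close>

primrec falling_op :: "(('x \<Rightarrow> complex) \<Rightarrow> 'x \<Rightarrow> complex) \<Rightarrow> nat \<Rightarrow> ('x \<Rightarrow> complex) \<Rightarrow> 'x \<Rightarrow> complex" where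
  "falling_op B 0 f = f"
| "falling_op B (Suc m) f = (\<lambda>x. B (falling_op B m f) x - of_nat m * falling_op B m f x)"

section \<open>Spectrum of a sum of one-site projections\<close>

text \<open>The identity on \<open>e\<^sub>0\<close> together with the averaging operator over the
  \<open>q - 1\<close> nonzero letters: the one-site projection behind \<open>N\<close>.\<close>

definition proj_loc :: "nat \<Rightarrow> nat \<Rightarrow> nat \<Rightarrow> complex" where
  "proj_loc q a b = (if a = 0 then if b = 0 then 1 else 0 else if b = 0 then 0 else 1 / (of_nat q - 1))"

lemma sum_split0:
  assumes "0 < (q::nat)"
  shows "(\<Sum>a<q. f a) = f 0 + (\<Sum>a\<in>{1..<q}. (f a :: complex))"
proof -
  have "{..<q} = insert 0 {1..<q}" using assms by auto
  then show ?thesis by simp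
qed

lemma sum_nonzero_const [simp]:
  assumes "0 < (q::nat)"
  shows "(\<Sum>a\<in>{1..<q}. c) = (of_nat q - 1) * (c::complex)"
  using assms by (simp add: of_nat_diff)

lemma of_nat_diff_one_nonzero:
  assumes "q \<ge> 2"
  shows "of_nat q - 1 \<noteq> (0 :: complex)"
proof -
  have "of_nat q \<noteq> (1 :: complex)" unfolding of_nat_eq_1_iff using assms by simp
  then show ?thesis by simp
qed

lemma proj_loc_idem:
  assumes "q \<ge> 2"
  shows "loc_mult q (proj_loc q) (proj_loc q) = proj_loc q"
proof -
  have "of_nat q - 1 \<noteq> (0::complex)" using assms by (rule of_nat_diff_one_nonzero)
  then show ?thesis
    using assms by (intro ext) (auto simp: loc_mult_def sum_split0 proj_loc_def)
qed

text \<open>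
  For the projection \<open>P\<close> at the last site, split \<open>f = P f + (f - P f)\<close>: on the first part the sum of all
  projections acts as \<open>Q + 1\<close> and on the second as \<open>Q\<close>, where \<open>Q\<close> is the sum over the other sites.
\<close>

lemma falling_op_proj_sum:
  assumes "q \<ge> 2"
  shows "falling_op (site_op q D (proj_loc q)) (Suc D) f = (\<lambda>_. 0)"
proof (induction D arbitrary: f)
  case 0
  then show ?case by (simp add: site_op_def)
next
  case (Suc D)
  let ?Q = "site_op q D (proj_loc q)"
  let ?P = "local_op q (proj_loc q) D"
  let ?S = "site_op q (Suc D) (proj_loc q)"
  let ?Q1 = "\<lambda>f x. ?Q f x + f x"
  have S: "?S f x = ?Q f x + ?P f x" for f x
    by (simp add: site_op_def)
  have PP: "?P (?P f) = ?P f" for f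
    by (simp add: local_op_mult proj_loc_idem[OF assms])
  have QP: "?Q (?P f) x = ?P (?Q f) x" for f x
    by (simp add: site_op_def local_op_sum local_op_commute[of _ D])
  have A: "falling_op ?S m (?P f) x = ?P (falling_op ?Q1 m f) x" for m f x
  proof (induction m arbitrary: x)
    case (Suc m)
    have "falling_op ?S m (?P f) = ?P (falling_op ?Q1 m f)"
      using Suc by auto
    then have "falling_op ?S (Suc m) (?P f) x
        = ?S (?P (falling_op ?Q1 m f)) x - of_nat m * ?P (falling_op ?Q1 m f) x"
      by (simp only: falling_op.simps)
    also have "\<dots> = ?P (falling_op ?Q1 (Suc m) f) x"
      by (simp add: S PP QP local_op_add local_op_diff local_op_cmult)
    finally show ?case .
  qed simp
  \<comment> \<open>The falling factorial of \<open>Q + 1\<close> of order \<open>m + 1\<close> is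
    \<open>(Q + 1) Q \<dots> (Q - m + 1)\<close>; splitting off \<open>Q + 1\<close> leaves the one
    of \<open>Q\<close> of order \<open>m\<close>. This is why one more site costs one more
    factor.\<close>
  have B: "falling_op ?Q1 (Suc m) f x = falling_op ?Q m (?Q1 f) x" for m f x
  proof (induction m arbitrary: x)
    case (Suc m)
    have "falling_op ?Q1 (Suc m) f = falling_op ?Q m (?Q1 f)"
      using Suc by blast
    then show ?case
      by (simp add: algebra_simps del: falling_op.simps(2)
          add: falling_op.simps(2)[of _ "Suc m"] falling_op.simps(2)[of ?Q m])
  qed simp
  have C: "falling_op ?S m (\<lambda>x. f x - ?P f x) x = falling_op ?Q m f x - ?P (falling_op ?Q m f) x" for m f x
  proof (induction m arbitrary: x)
    case (Suc m)
    have "falling_op ?S m (\<lambda>x. f x - ?P f x) = (\<lambda>x. falling_op ?Q m f x - ?P (falling_op ?Q m f) x)"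
      using Suc by blast
    then have "falling_op ?S (Suc m) (\<lambda>x. f x - ?P f x) x
        = ?S (\<lambda>x. falling_op ?Q m f x - ?P (falling_op ?Q m f) x) x
          - of_nat m * (falling_op ?Q m f x - ?P (falling_op ?Q m f) x)"
      by (simp only: falling_op.simps)
    also have "\<dots> = falling_op ?Q (Suc m) f x - ?P (falling_op ?Q (Suc m) f) x"
      by (simp add: S PP QP site_op_diff local_op_diff local_op_cmult algebra_simps)
    finally show ?case .
  qed simp
  have add: "falling_op ?S m (\<lambda>x. f x + g x) x = falling_op ?S m f x + falling_op ?S m g x" for m f g x
  proof (induction m arbitrary: x)
    case (Suc m)
    have "falling_op ?S m (\<lambda>x. f x + g x) = (\<lambda>x. falling_op ?S m f x + falling_op ?S m g x)"
      using Suc by blast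
    then show ?case
      by (simp add: site_op_add algebra_simps)
  qed simp
  show ?case
  proof
    fix x
    have "falling_op ?S (Suc (Suc D)) f x
        = falling_op ?S (Suc (Suc D)) (\<lambda>x. ?P f x + (f x - ?P f x)) x"
      by simp
    also have "\<dots> = ?P (falling_op ?Q1 (Suc (Suc D)) f) x
        + (falling_op ?Q (Suc (Suc D)) f x - ?P (falling_op ?Q (Suc (Suc D)) f) x)"
      unfolding add A C ..
    also have "falling_op ?Q1 (Suc (Suc D)) f = (\<lambda>_. 0)"
      unfolding B[abs_def] Suc.IH ..
    \<comment> \<open>Order \<open>D + 1\<close> already gives zero, and the additional factor acts
      on the zero function.\<close>
    also have "falling_op ?Q (Suc (Suc D)) f = (\<lambda>_. 0)"
      unfolding falling_op.simps(2)[of _ "Suc D"] Suc.IH by (simp add: site_op_def local_op_def)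
    finally show "falling_op ?S (Suc (Suc D)) f x = 0"
      by (simp add: local_op_def)
  qed
qed

section \<open>The Terwilliger algebra in terms of one-site matrices\<close>

lemma cmat_ring_simps [simp]:
  "M \<in> carrier (cmat_ring S) \<longleftrightarrow> (\<forall>x y. x \<notin> S \<or> y \<notin> S \<longrightarrow> M x y = 0)"
  "M \<otimes>\<^bsub>cmat_ring S\<^esub> N = (\<lambda>x y. \<Sum>z\<in>S. M x z * N z y)"
  "\<one>\<^bsub>cmat_ring S\<^esub> = scalar_cmat S 1"
  "\<zero>\<^bsub>cmat_ring S\<^esub> = (\<lambda>x y. 0)"
  "M \<oplus>\<^bsub>cmat_ring S\<^esub> N = (\<lambda>x y. M x y + N x y)"
  by (simp_all add: cmat_ring_def)

lemma scalar_cmat_apply: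
  "scalar_cmat S c x y = (if x \<in> S \<and> x = y then c else 0)"
  by (simp add: scalar_cmat_def diag_cmat_def)

lemma sum_scalar_cmat_left:
  assumes "finite S"
  shows "(\<Sum>z\<in>S. scalar_cmat S c x z * f z) = (if x \<in> S then c * f x else 0)"
proof -
  have "(\<Sum>z\<in>S. scalar_cmat S c x z * f z) = (\<Sum>z\<in>S. if z = x then c * f x else 0)"
    by (intro sum.cong) (auto simp: scalar_cmat_apply)
  then show ?thesis using assms by simp
qed

lemma sum_scalar_cmat_right:
  assumes "finite S"
  shows "(\<Sum>z\<in>S. f z * scalar_cmat S c z y) = (if y \<in> S then c * f y else 0)"
proof -
  have "(\<Sum>z\<in>S. f z * scalar_cmat S c z y) = (\<Sum>z\<in>S. if z = y then c * f y else 0)"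
    by (intro sum.cong) (auto simp: scalar_cmat_apply)
  then show ?thesis using assms by simp
qed

lemma cmat_mult_assoc:
  "(\<Sum>z\<in>S. (\<Sum>w\<in>S. M w * N w z) * P z) = (\<Sum>w\<in>S. M w * (\<Sum>z\<in>S. N w z * (P z :: complex)))"
proof -
  have "(\<Sum>z\<in>S. (\<Sum>w\<in>S. M w * N w z) * P z) = (\<Sum>z\<in>S. \<Sum>w\<in>S. M w * N w z * P z)"
    by (simp add: sum_distrib_right)
  also have "\<dots> = (\<Sum>w\<in>S. \<Sum>z\<in>S. M w * N w z * P z)"
    by (rule sum.swap)
  finally show ?thesis by (simp add: sum_distrib_left mult.assoc)
qed

lemma ring_cmat_ring:
  assumes "finite S"
  shows "ring (cmat_ring S)"
proof (rule ringI)
  show "abelian_group (cmat_ring S)"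
  proof (rule abelian_groupI)
    fix M assume "M \<in> carrier (cmat_ring S)"
    then show "\<exists>N\<in>carrier (cmat_ring S). N \<oplus>\<^bsub>cmat_ring S\<^esub> M = \<zero>\<^bsub>cmat_ring S\<^esub>"
      by (intro bexI[of _ "\<lambda>x y. - M x y"]) auto
  qed (auto simp: algebra_simps)
  show "monoid (cmat_ring S)"
  proof (rule monoidI)
    fix M N P
    assume "M \<in> carrier (cmat_ring S)" "N \<in> carrier (cmat_ring S)" "P \<in> carrier (cmat_ring S)"
    then show "M \<otimes>\<^bsub>cmat_ring S\<^esub> N \<otimes>\<^bsub>cmat_ring S\<^esub> P = M \<otimes>\<^bsub>cmat_ring S\<^esub> (N \<otimes>\<^bsub>cmat_ring S\<^esub> P)"
      by (simp only: cmat_ring_simps cmat_mult_assoc)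
  qed (use assms in \<open>auto simp: sum_scalar_cmat_left sum_scalar_cmat_right intro!: ext\<close>,
      auto simp: scalar_cmat_apply)
qed (auto simp: algebra_simps sum.distrib)

lemma finite_hvertices [simp]: "finite (hvertices q D)"
  by (simp add: hvertices_def finite_PiE)

lemma hvertices_upd: "x \<in> hvertices q D \<Longrightarrow> i < D \<Longrightarrow> a < q \<Longrightarrow> x(i := a) \<in> hvertices q D"
  by (auto simp: hvertices_def PiE_def extensional_def)

lemma hvertices_less: "x \<in> hvertices q D \<Longrightarrow> i < D \<Longrightarrow> x i < q"
  by (auto simp: hvertices_def)

text \<open>Replacing one letter of a vertex by a letter below \<open>q\<close> gives a vertex
  again, so the value at a vertex only involves values at vertices. This allows truncating functions
  outside the vertex set.\<close>

lemma site_op_cong: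
  assumes "x \<in> hvertices q D" "\<And>y. y \<in> hvertices q D \<Longrightarrow> f y = g y"
  shows "site_op q D M f x = site_op q D M g x"
  using assms by (auto simp: site_op_def local_op_def hvertices_upd intro!: sum.cong)

definition site_mat :: "nat \<Rightarrow> nat \<Rightarrow> (nat \<Rightarrow> nat \<Rightarrow> complex) \<Rightarrow> (nat \<Rightarrow> nat) cmat" where
  "site_mat q D M = (\<lambda>x y. if x \<in> hvertices q D \<and> y \<in> hvertices q D
     then site_op q D M (\<lambda>z. if z = y then 1 else 0) x else 0)"

text \<open>On the vertices \<open>f\<close> is a linear combination of indicator functions, and
  \<open>site_op\<close> is linear.\<close>

lemma site_mat_apply:
  "(\<Sum>y\<in>hvertices q D. site_mat q D M x y * f y) = (if x \<in> hvertices q D then site_op q D M f x else 0)"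
proof (cases "x \<in> hvertices q D")
  case True
  have "(\<Sum>y\<in>hvertices q D. site_mat q D M x y * f y)
      = (\<Sum>y\<in>hvertices q D. site_op q D M (\<lambda>z. f y * (if z = y then 1 else 0)) x)"
    using True by (intro sum.cong refl) (simp add: site_mat_def site_op_cmult)
  also have "\<dots> = site_op q D M (\<lambda>z. \<Sum>y\<in>hvertices q D. f y * (if z = y then 1 else 0)) x"
    by (simp add: site_op_sum)
  also have "\<dots> = site_op q D M f x"
    using True by (intro site_op_cong) (auto simp: sum.delta' if_distrib cong: if_cong)
  finally show ?thesis using True by simp
qed (simp add: site_mat_def)

text \<open>The product is kept as a composition of operators, the form to which
  \<open>site_op_commutator\<close> applies.\<close>

lemma site_mat_mult:
  "(\<lambda>x y. \<Sum>z\<in>hvertices q D. site_mat q D M x z * site_mat q D N z y)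
    = (\<lambda>x y. if x \<in> hvertices q D \<and> y \<in> hvertices q D
        then site_op q D M (site_op q D N (\<lambda>z. if z = y then 1 else 0)) x else 0)"
  unfolding site_mat_apply
proof (intro ext)
  fix x y
  have "site_op q D M (\<lambda>z. site_mat q D N z y) x = site_op q D M (site_op q D N (\<lambda>z. if z = y then 1 else 0)) x"
    if "x \<in> hvertices q D" "y \<in> hvertices q D"
    using that by (intro site_op_cong) (auto simp: site_mat_def)
  moreover have "site_op q D M (\<lambda>z. site_mat q D N z y) x = 0" if "y \<notin> hvertices q D"
    using that by (simp add: site_mat_def site_op_def local_op_def)
  ultimately show "(if x \<in> hvertices q D then site_op q D M (\<lambda>z. site_mat q D N z y) x else 0)
    = (if x \<in> hvertices q D \<and> y \<in> hvertices q D
        then site_op q D M (site_op q D N (\<lambda>z. if z = y then 1 else 0)) x else 0)"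
    by auto
qed

lemma site_mat_commutator:
  assumes "\<And>a b. loc_mult q M N a b = loc_mult q N M a b + K a b"
  shows "site_mat q D M \<otimes>\<^bsub>cmat_ring (hvertices q D)\<^esub> site_mat q D N
    = site_mat q D N \<otimes>\<^bsub>cmat_ring (hvertices q D)\<^esub> site_mat q D M
      \<oplus>\<^bsub>cmat_ring (hvertices q D)\<^esub> site_mat q D K"
  by (auto simp: site_mat_mult site_op_commutator[OF assms] intro!: ext) (auto simp: site_mat_def)

lemma site_mat_add:
  "site_mat q D (\<lambda>a b. M a b + N a b) = site_mat q D M \<oplus>\<^bsub>cmat_ring (hvertices q D)\<^esub> site_mat q D N"
  by (auto simp: site_mat_def site_op_def local_op_def sum.distrib distrib_right intro!: ext)

lemma site_mat_cmult:
  "site_mat q D (\<lambda>a b. c * M a b)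
    = scalar_cmat (hvertices q D) c \<otimes>\<^bsub>cmat_ring (hvertices q D)\<^esub> site_mat q D M"
  by (auto simp: sum_scalar_cmat_left site_mat_def site_op_def local_op_def sum_distrib_left mult_ac intro!: ext)

section \<open>The one-site matrices behind the two adjacency matrices\<close>

definition delta_loc :: "nat \<Rightarrow> nat \<Rightarrow> complex" where
  "delta_loc a b = (if a = b then 1 else 0)"

definition zero_loc :: "nat \<Rightarrow> nat \<Rightarrow> complex" where
  "zero_loc a b = (if a = 0 \<and> b = 0 then 1 else 0)"

text \<open>The first argument is the row: each \<open>e\<^sub>b\<close> with
  \<open>b \<noteq> 0\<close> goes to \<open>e\<^sub>0\<close>. What is lowered is the distance to
  the zero vertex, so the eigenvalue of \<open>Z\<close> goes up by one.\<close>

definition lower_loc :: "nat \<Rightarrow> nat \<Rightarrow> complex" where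
  "lower_loc a b = (if a = 0 \<and> b \<noteq> 0 then 1 else 0)"

definition raise_loc :: "nat \<Rightarrow> nat \<Rightarrow> complex" where
  "raise_loc a b = (if a \<noteq> 0 \<and> b = 0 then 1 else 0)"

definition adj_loc :: "nat \<Rightarrow> nat \<Rightarrow> complex" where
  "adj_loc a b = (if a = b then 0 else 1)"

definition hzeros :: "nat \<Rightarrow> (nat \<Rightarrow> nat) \<Rightarrow> nat" where
  "hzeros D x = card {i. i < D \<and> x i = 0}"

lemma hzeros_eq_sum: "of_nat (hzeros D x) = (\<Sum>i<D. if x i = 0 then 1 else (0::complex))"
proof -
  have "{..<D} \<inter> {i. x i = 0} = {i. i < D \<and> x i = 0}" by auto
  then show ?thesis by (simp add: hzeros_def sum.If_cases)
qed

lemma hzeros_le: "hzeros D x \<le> D"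
proof -
  have "hzeros D x \<le> card {..<D}" unfolding hzeros_def by (intro card_mono) auto
  then show ?thesis by simp
qed

lemma site_op_delta:
  assumes "x \<in> hvertices q D"
  shows "site_op q D delta_loc f x = of_nat D * f x"
proof -
  have "local_op q delta_loc i f x = f x" if "i < D" for i
  proof -
    have "local_op q delta_loc i f x = (\<Sum>a<q. if a = x i then f x else 0)"
      unfolding local_op_def by (intro sum.cong) (auto simp: delta_loc_def)
    then show ?thesis using hvertices_less[OF assms that] by simp
  qed
  then show ?thesis by (simp add: site_op_def)
qed

lemma site_op_zero:
  assumes "q > 0"
  shows "site_op q D zero_loc f x = of_nat (hzeros D x) * f x"
proof -
  have "local_op q zero_loc i f x = (if x i = 0 then 1 else 0) * f x" for i
  proof -
    have "local_op q zero_loc i f x = (\<Sum>a<q. if a = 0 then (if x i = 0 then 1 else 0) * f x else 0)"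
      unfolding local_op_def by (intro sum.cong) (auto simp: zero_loc_def fun_upd_idem)
    then show ?thesis using assms by simp
  qed
  then show ?thesis unfolding site_op_def hzeros_eq_sum sum_distrib_right by simp
qed

lemma scalar_cmat_eq_site_mat:
  "scalar_cmat (hvertices q D) (of_nat D) = site_mat q D delta_loc"
  by (auto simp: scalar_cmat_apply site_mat_def site_op_delta intro!: ext)

text \<open>The distance from the zero vertex is \<open>D - Z\<close>, so the diagonal entry
  \<open>D (q - 1) - q (D - Z)\<close> equals \<open>q Z - D\<close>.\<close>

lemma dual_adj_mat_eq_site_mat:
  assumes "q > 0"
  shows "dual_adj_mat q D = site_mat q D (\<lambda>a b. of_nat q * zero_loc a b + (-1) * delta_loc a b)"
proof (intro ext)
  fix x y
  have dist: "of_nat (hdist D (hzero D) x) = (of_nat D - of_nat (hzeros D x) :: complex)" for x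
  proof -
    have "{i. i < D \<and> hzero D i \<noteq> x i} = {..<D} - {i. i < D \<and> x i = 0}"
      by (auto simp: hzero_def)
    then have "hdist D (hzero D) x = D - hzeros D x"
      unfolding hdist_def hzeros_def by (simp add: card_Diff_subset subset_eq)
    then show ?thesis using hzeros_le[of D x] by (simp add: of_nat_diff)
  qed
  show "dual_adj_mat q D x y = site_mat q D (\<lambda>a b. of_nat q * zero_loc a b + (-1) * delta_loc a b) x y"
    unfolding site_mat_add site_mat_cmult
    by (simp add: sum_scalar_cmat_left)
       (auto simp: dual_adj_mat_def diag_cmat_def dist site_mat_def site_op_zero[OF assms] site_op_delta algebra_simps)
qed

text \<open>At each site \<open>adj_loc\<close> replaces the letter by every other letter; adjacent
  vertices are related by exactly one such replacement, all other pairs by none.\<close>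

lemma adj_mat_eq_site_mat: "adj_mat q D = site_mat q D adj_loc"
proof (intro ext)
  fix x y
  consider (out) "x \<notin> hvertices q D \<or> y \<notin> hvertices q D"
    | (adj) "x \<in> hvertices q D" "y \<in> hvertices q D" "hdist D x y = 1"
    | (far) "x \<in> hvertices q D" "y \<in> hvertices q D" "hdist D x y \<noteq> 1"
    by blast
  then show "adj_mat q D x y = site_mat q D adj_loc x y"
  proof cases
    case out
    then show ?thesis by (auto simp: adj_mat_def hadjacent_def site_mat_def)
  next
    case adj
    then obtain j where j: "{i. i < D \<and> x i \<noteq> y i} = {j}"
      unfolding hdist_def by (auto simp: card_1_singleton_iff)
    then have jD: "j < D" "x j \<noteq> y j" by auto
    have out: "x i = y i" if "i \<noteq> j" for i
    proof (cases "i < D")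
      case True
      then show ?thesis using j that by blast
    next
      case False
      then show ?thesis using adj by (auto simp: hvertices_def PiE_def extensional_def)
    qed
    have y: "x(j := y j) = y" using out by auto
    \<comment> \<open>Only the site \<open>j\<close> where the vertices differ, with the letter
      \<open>y j\<close>, contributes to the double sum.\<close>
    have *: "adj_loc (x i) a * (if x(i := a) = y then 1 else 0)
        = (if i = j then if a = y j then 1 else 0 else 0)" for i a
    proof (cases "i = j \<and> a = y j")
      case True
      then show ?thesis using y jD by (simp add: adj_loc_def)
    next
      case False
      have "x(i := a) \<noteq> y" if "a \<noteq> x i"
      proof
        assume eq: "x(i := a) = y"
        then have "y i = a" by auto
        with that out have "i = j" by metis
        with False \<open>y i = a\<close> show False by simp
      qed
      then show ?thesis using False by (auto simp: adj_loc_def)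
    qed
    have "site_mat q D adj_loc x y = (\<Sum>i<D. \<Sum>a<q. if i = j then if a = y j then 1 else 0 else 0)"
      using adj by (simp add: site_mat_def site_op_def local_op_def *)
    also have "\<dots> = (\<Sum>i<D. if i = j then 1 else 0)"
      using adj jD hvertices_less[of y q D j] by (intro sum.cong) auto
    finally show ?thesis
      using adj jD by (simp add: adj_mat_def hadjacent_def)
  next
    case far
    have "adj_loc (x i) a * (if x(i := a) = y then 1 else 0) = 0" if "i < D" for i a
    proof (cases "x(i := a) = y \<and> x i \<noteq> a")
      case True
      then have "{k. k < D \<and> x k \<noteq> y k} = {i}" using that by (auto split: if_splits)
      then show ?thesis using far unfolding hdist_def by simp
    qed (auto simp: adj_loc_def)
    then have "site_mat q D adj_loc x y = 0"
      using far unfolding site_mat_def site_op_def local_op_def by (simp only: if_True simp_thms) (intro sum.neutral ballI, simp)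
    then show ?thesis using far by (simp add: adj_mat_def hadjacent_def)
  qed
qed

section \<open>The Terwilliger algebra as a ring and induction over it\<close>

lemma generators_closed:
  "{adj_mat q D, dual_adj_mat q D} \<union> range (scalar_cmat (hvertices q D)) \<subseteq> carrier (cmat_ring (hvertices q D))"
  by (auto simp: adj_mat_def hadjacent_def dual_adj_mat_def scalar_cmat_apply diag_cmat_def)

lemma ring_terwilliger: "ring (terwilliger_algebra q D)"
  unfolding terwilliger_algebra_def generated_algebra_def
  by (rule ring.generate_ring_is_ring[OF ring_cmat_ring[OF finite_hvertices] generators_closed])

lemma terwilliger_simps:
  "M \<otimes>\<^bsub>terwilliger_algebra q D\<^esub> N = M \<otimes>\<^bsub>cmat_ring (hvertices q D)\<^esub> N"
  "M \<oplus>\<^bsub>terwilliger_algebra q D\<^esub> N = M \<oplus>\<^bsub>cmat_ring (hvertices q D)\<^esub> N"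
  "\<one>\<^bsub>terwilliger_algebra q D\<^esub> = scalar_cmat (hvertices q D) 1"
  "\<zero>\<^bsub>terwilliger_algebra q D\<^esub> = (\<lambda>x y. 0)"
  by (simp_all add: terwilliger_algebra_def generated_algebra_def)

lemma scalar_in_terwilliger [simp]: "scalar_cmat (hvertices q D) c \<in> carrier (terwilliger_algebra q D)"
  by (auto simp: terwilliger_algebra_def generated_algebra_def intro: generate_ring.incl)

lemma generators_in_terwilliger [simp]:
  "adj_mat q D \<in> carrier (terwilliger_algebra q D)" "dual_adj_mat q D \<in> carrier (terwilliger_algebra q D)"
  by (auto simp: terwilliger_algebra_def generated_algebra_def intro: generate_ring.incl)

lemma terwilliger_in_cmat:
  assumes "a \<in> carrier (terwilliger_algebra q D)"
  shows "a \<in> carrier (cmat_ring (hvertices q D))"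
proof -
  have "a \<in> generate_ring (cmat_ring (hvertices q D))
      ({adj_mat q D, dual_adj_mat q D} \<union> range (scalar_cmat (hvertices q D)))"
    using assms by (simp add: terwilliger_algebra_def generated_algebra_def)
  with ring.generate_ring_incl[OF ring_cmat_ring[OF finite_hvertices] generators_closed]
  show ?thesis by (rule subsetD)
qed

text \<open>Negatives in the generated ring are products with the scalar matrix of -1, and the unit
  is itself a scalar matrix; the scalar and product cases therefore cover both.\<close>

lemma terwilliger_induct [consumes 1, case_names scalar adj dual add mult]:
  assumes "a \<in> carrier (terwilliger_algebra q D)"
    and "\<And>c. P (scalar_cmat (hvertices q D) c)" "P (adj_mat q D)" "P (dual_adj_mat q D)"
    and add: "\<And>a b. a \<in> carrier (terwilliger_algebra q D) \<Longrightarrow> b \<in> carrier (terwilliger_algebra q D)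
      \<Longrightarrow> P a \<Longrightarrow> P b \<Longrightarrow> P (a \<oplus>\<^bsub>terwilliger_algebra q D\<^esub> b)"
    and mult: "\<And>a b. a \<in> carrier (terwilliger_algebra q D) \<Longrightarrow> b \<in> carrier (terwilliger_algebra q D)
      \<Longrightarrow> P a \<Longrightarrow> P b \<Longrightarrow> P (a \<otimes>\<^bsub>terwilliger_algebra q D\<^esub> b)"
  shows "P a"
proof -
  let ?G = "{adj_mat q D, dual_adj_mat q D} \<union> range (scalar_cmat (hvertices q D))"
  interpret C: ring "cmat_ring (hvertices q D)" by (rule ring_cmat_ring) simp
  have T: "carrier (terwilliger_algebra q D) = generate_ring (cmat_ring (hvertices q D)) ?G"
    by (simp add: terwilliger_algebra_def generated_algebra_def)
  show ?thesis
    using assms(1) unfolding T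
  proof (induction a rule: generate_ring.induct)
    case (a_inv h)
    have h: "h \<in> carrier (terwilliger_algebra q D)" using a_inv by (simp add: T)
    then have "h \<in> carrier (cmat_ring (hvertices q D))" by (rule terwilliger_in_cmat)
    moreover from this have "scalar_cmat (hvertices q D) (-1) \<otimes>\<^bsub>terwilliger_algebra q D\<^esub> h = (\<lambda>x y. - h x y)"
      by (auto simp: terwilliger_simps sum_scalar_cmat_left intro!: ext)
    ultimately have "\<ominus>\<^bsub>cmat_ring (hvertices q D)\<^esub> h = scalar_cmat (hvertices q D) (-1) \<otimes>\<^bsub>terwilliger_algebra q D\<^esub> h"
      by (intro C.minus_equality) auto
    moreover have "P (scalar_cmat (hvertices q D) (-1) \<otimes>\<^bsub>terwilliger_algebra q D\<^esub> h)"
      by (rule mult) (use h assms a_inv in auto)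
    ultimately show ?case by simp
  next
    case (eng_add a b)
    then have "P (a \<oplus>\<^bsub>terwilliger_algebra q D\<^esub> b)" by (intro add) (simp_all add: T)
    then show ?case by (simp only: terwilliger_simps)
  next
    case (eng_mult a b)
    then have "P (a \<otimes>\<^bsub>terwilliger_algebra q D\<^esub> b)" by (intro mult) (simp_all add: T)
    then show ?case by (simp only: terwilliger_simps)
  qed (use assms in auto)
qed

text \<open>
  Since \<open>site_mat\<close> turns commutators into commutators, this is a Lie algebra of one-site matrices, and the
  membership of \<open>Z, N, L, R\<close> in the Terwilliger algebra reduces to identities between matrices on one site.
\<close>

definition site_algebra :: "nat \<Rightarrow> nat \<Rightarrow> (nat \<Rightarrow> nat \<Rightarrow> complex) set" where
  "site_algebra q D = {M. site_mat q D M \<in> carrier (terwilliger_algebra q D)}"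

lemma site_algebra_add:
  assumes "M \<in> site_algebra q D" "N \<in> site_algebra q D"
  shows "(\<lambda>a b. M a b + N a b) \<in> site_algebra q D"
proof -
  interpret T: ring "terwilliger_algebra q D" by (rule ring_terwilliger)
  show ?thesis
    using T.add.m_closed assms by (simp add: site_algebra_def site_mat_add terwilliger_simps)
qed

lemma site_algebra_cmult:
  assumes "M \<in> site_algebra q D"
  shows "(\<lambda>a b. c * M a b) \<in> site_algebra q D"
proof -
  interpret T: ring "terwilliger_algebra q D" by (rule ring_terwilliger)
  show ?thesis
    using T.m_closed[OF scalar_in_terwilliger] assms
    by (simp only: site_algebra_def site_mat_cmult terwilliger_simps mem_Collect_eq)
qed

lemma site_algebra_commutator:
  assumes "M \<in> site_algebra q D" "N \<in> site_algebra q D" "\<And>a b. loc_mult q M N a b = loc_mult q N M a b + K a b"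
  shows "K \<in> site_algebra q D"
proof -
  interpret T: ring "terwilliger_algebra q D" by (rule ring_terwilliger)
  let ?T = "terwilliger_algebra q D"
  let ?M = "site_mat q D M" and ?N = "site_mat q D N" and ?K = "site_mat q D K"
  have "?M \<otimes>\<^bsub>?T\<^esub> ?N \<oplus>\<^bsub>?T\<^esub> (scalar_cmat (hvertices q D) (-1) \<otimes>\<^bsub>?T\<^esub> (?N \<otimes>\<^bsub>?T\<^esub> ?M)) \<in> carrier ?T"
    using assms(1,2) by (intro T.add.m_closed T.m_closed) (auto simp: site_algebra_def)
  also have "?M \<otimes>\<^bsub>?T\<^esub> ?N \<oplus>\<^bsub>?T\<^esub> (scalar_cmat (hvertices q D) (-1) \<otimes>\<^bsub>?T\<^esub> (?N \<otimes>\<^bsub>?T\<^esub> ?M)) = ?K"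
    unfolding terwilliger_simps site_mat_commutator[OF assms(3)]
    by (auto simp: sum_scalar_cmat_left site_mat_mult site_mat_def intro!: ext)
  finally show ?thesis by (simp add: site_algebra_def)
qed

text \<open>All relations have the shape \<open>MN = NM + K\<close> expected by
  \<open>site_op_commutator\<close>. A vanishing commutator is written as a zero multiple of
  \<open>delta_loc\<close>, so that \<open>act_cmult\<close> can evaluate it on a module. The last
  relation serves to separate \<open>L\<close> from \<open>R\<close>.\<close>

lemma loc_relations:
  assumes "q \<ge> 2"
  shows "loc_mult q zero_loc adj_loc a b = loc_mult q adj_loc zero_loc a b + (lower_loc a b - raise_loc a b)"
    and "loc_mult q zero_loc lower_loc a b = loc_mult q lower_loc zero_loc a b + lower_loc a b"
    and "loc_mult q zero_loc raise_loc a b = loc_mult q raise_loc zero_loc a b + (-1) * raise_loc a b"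
    and "loc_mult q lower_loc raise_loc a b = loc_mult q raise_loc lower_loc a b
      + (of_nat q - 1) * (2 * zero_loc a b + (-1) * proj_loc q a b)"
    and "loc_mult q (proj_loc q) lower_loc a b = loc_mult q lower_loc (proj_loc q) a b + 0 * delta_loc a b"
    and "loc_mult q (proj_loc q) raise_loc a b = loc_mult q raise_loc (proj_loc q) a b + 0 * delta_loc a b"
    and "loc_mult q (proj_loc q) zero_loc a b = loc_mult q zero_loc (proj_loc q) a b + 0 * delta_loc a b"
    and "loc_mult q zero_loc (\<lambda>a b. lower_loc a b - raise_loc a b) a b
      = loc_mult q (\<lambda>a b. lower_loc a b - raise_loc a b) zero_loc a b + (lower_loc a b + raise_loc a b)"
proof -
  have q1: "of_nat q - 1 \<noteq> (0::complex)"
    using assms by (rule of_nat_diff_one_nonzero)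
  note defs = loc_mult_def sum_split0 zero_loc_def adj_loc_def lower_loc_def raise_loc_def proj_loc_def
  show "loc_mult q zero_loc adj_loc a b = loc_mult q adj_loc zero_loc a b + (lower_loc a b - raise_loc a b)"
    "loc_mult q zero_loc lower_loc a b = loc_mult q lower_loc zero_loc a b + lower_loc a b"
    "loc_mult q zero_loc raise_loc a b = loc_mult q raise_loc zero_loc a b + (-1) * raise_loc a b"
    "loc_mult q lower_loc raise_loc a b = loc_mult q raise_loc lower_loc a b
      + (of_nat q - 1) * (2 * zero_loc a b + (-1) * proj_loc q a b)"
    "loc_mult q (proj_loc q) lower_loc a b = loc_mult q lower_loc (proj_loc q) a b + 0 * delta_loc a b"
    "loc_mult q (proj_loc q) raise_loc a b = loc_mult q raise_loc (proj_loc q) a b + 0 * delta_loc a b"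
    "loc_mult q (proj_loc q) zero_loc a b = loc_mult q zero_loc (proj_loc q) a b + 0 * delta_loc a b"
    "loc_mult q zero_loc (\<lambda>a b. lower_loc a b - raise_loc a b) a b
      = loc_mult q (\<lambda>a b. lower_loc a b - raise_loc a b) zero_loc a b + (lower_loc a b + raise_loc a b)"
    using assms q1 by (auto simp: defs)
qed

text \<open>On the nonzero letters the all-ones block is \<open>q - 1\<close> times the averaging
  projection. The \<open>zero_loc\<close> term then repairs the entry at the letter 0, and
  \<open>delta_loc\<close> clears the diagonal.\<close>

lemma adj_loc_eq:
  assumes "q \<ge> 2"
  shows "adj_loc a b = lower_loc a b + raise_loc a b + (of_nat q - 1) * proj_loc q a b
    - (of_nat q - 2) * zero_loc a b - delta_loc a b"
proof -
  have q1: "of_nat q - 1 \<noteq> (0::complex)"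
    using assms by (rule of_nat_diff_one_nonzero)
  then show ?thesis
    by (auto simp: adj_loc_def lower_loc_def raise_loc_def proj_loc_def zero_loc_def delta_loc_def)
qed

text \<open>First \<open>Z\<close> is read off from \<open>A\<^sup>*\<close>. Then
  \<open>[Z,A] = L - R\<close> and \<open>[Z,L - R] = L + R\<close> give \<open>L\<close> and
  \<open>R\<close>, and solving \<open>adj_loc_eq\<close> for the projection gives
  \<open>N\<close>.\<close>

lemma site_algebra_members:
  assumes "q \<ge> 2"
  shows "delta_loc \<in> site_algebra q D" "zero_loc \<in> site_algebra q D" "adj_loc \<in> site_algebra q D"
    "lower_loc \<in> site_algebra q D" "raise_loc \<in> site_algebra q D" "proj_loc q \<in> site_algebra q D"
proof -
  have q1: "of_nat q - 1 \<noteq> (0::complex)" "of_nat q \<noteq> (0::complex)"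
    using of_nat_diff_one_nonzero[OF assms] assms by simp_all
  show d: "delta_loc \<in> site_algebra q D"
    using scalar_in_terwilliger[of q D "of_nat D"] by (simp add: site_algebra_def scalar_cmat_eq_site_mat)
  have "(\<lambda>a b. of_nat q * zero_loc a b + (-1) * delta_loc a b) \<in> site_algebra q D"
    using generators_in_terwilliger(2)[of q D] assms by (simp add: site_algebra_def dual_adj_mat_eq_site_mat)
  from site_algebra_cmult[OF site_algebra_add[OF this d], of "1 / of_nat q"]
  have "(\<lambda>a b. 1 / of_nat q * ((of_nat q * zero_loc a b + (-1) * delta_loc a b) + delta_loc a b)) \<in> site_algebra q D" .
  then show z: "zero_loc \<in> site_algebra q D"
    using q1 by simp
  show a: "adj_loc \<in> site_algebra q D"
    using generators_in_terwilliger(1)[of q D] by (simp add: site_algebra_def adj_mat_eq_site_mat)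
  have k1: "(\<lambda>a b. lower_loc a b - raise_loc a b) \<in> site_algebra q D"
    by (rule site_algebra_commutator[OF z a]) (rule loc_relations[OF assms])
  have k2: "(\<lambda>a b. lower_loc a b + raise_loc a b) \<in> site_algebra q D"
    by (rule site_algebra_commutator[OF z k1]) (rule loc_relations[OF assms])
  show l: "lower_loc \<in> site_algebra q D"
    using site_algebra_cmult[OF site_algebra_add[OF k1 k2], of "1 / 2"] by simp
  show r: "raise_loc \<in> site_algebra q D"
    using site_algebra_add[OF k2 site_algebra_cmult[OF l, of "-1"]] by simp
  have "(\<lambda>a b. 1 / (of_nat q - 1) * ((adj_loc a b + (-1) * (lower_loc a b + raise_loc a b))
      + ((of_nat q - 2) * zero_loc a b + delta_loc a b))) \<in> site_algebra q D"
    by (intro site_algebra_cmult site_algebra_add a k2 z d)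
  also have "(\<lambda>a b. 1 / (of_nat q - 1) * ((adj_loc a b + (-1) * (lower_loc a b + raise_loc a b))
      + ((of_nat q - 2) * zero_loc a b + delta_loc a b))) = proj_loc q"
    using q1 by (intro ext) (simp add: adj_loc_eq[OF assms])
  finally show "proj_loc q \<in> site_algebra q D" .
qed

section \<open>Annihilating polynomials of \<open>Z\<close> and \<open>N\<close> inside the
  algebra\<close>

primrec falling_mat :: "nat \<Rightarrow> nat \<Rightarrow> (nat \<Rightarrow> nat \<Rightarrow> complex) \<Rightarrow> nat \<Rightarrow> (nat \<Rightarrow> nat) cmat" where
  "falling_mat q D M 0 = \<one>\<^bsub>terwilliger_algebra q D\<^esub>"
| "falling_mat q D M (Suc m) =
     site_mat q D M \<otimes>\<^bsub>terwilliger_algebra q D\<^esub> falling_mat q D M m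
       \<oplus>\<^bsub>terwilliger_algebra q D\<^esub>
     scalar_cmat (hvertices q D) (- of_nat m) \<otimes>\<^bsub>terwilliger_algebra q D\<^esub> falling_mat q D M m"

lemma falling_mat_closed:
  assumes "M \<in> site_algebra q D"
  shows "falling_mat q D M m \<in> carrier (terwilliger_algebra q D)"
proof -
  interpret T: ring "terwilliger_algebra q D" by (rule ring_terwilliger)
  show ?thesis
    using assms by (induction m) (auto simp: site_algebra_def)
qed

text \<open>Carries the vanishing of a falling factorial from operators on functions to an identity
  in the algebra, which then holds on every module.\<close>

lemma falling_mat_eq:
  "falling_mat q D M m = (\<lambda>x y. if x \<in> hvertices q D \<and> y \<in> hvertices q D
     then falling_op (site_op q D M) m (\<lambda>z. if z = y then 1 else 0) x else 0)"
proof (induction m)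
  case 0
  then show ?case by (auto simp: terwilliger_simps scalar_cmat_apply intro!: ext)
next
  case (Suc m)
  show ?case
  proof (intro ext)
    fix x y
    have "site_op q D M (\<lambda>z. falling_mat q D M m z y) x
        = (if y \<in> hvertices q D then
            site_op q D M (falling_op (site_op q D M) m (\<lambda>z. if z = y then 1 else 0)) x else 0)"
      if x: "x \<in> hvertices q D"
    proof (cases "y \<in> hvertices q D")
      case True
      with x show ?thesis by (simp, intro site_op_cong) (auto simp: Suc)
    qed (simp add: Suc site_op_def local_op_def)
    then show "falling_mat q D M (Suc m) x y = (if x \<in> hvertices q D \<and> y \<in> hvertices q D
     then falling_op (site_op q D M) (Suc m) (\<lambda>z. if z = y then 1 else 0) x else 0)"
      by (simp add: terwilliger_simps site_mat_apply sum_scalar_cmat_left)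
         (simp add: Suc)
  qed
qed

lemma falling_mat_proj:
  assumes "q \<ge> 2"
  shows "falling_mat q D (proj_loc q) (Suc D) = \<zero>\<^bsub>terwilliger_algebra q D\<^esub>"
  unfolding falling_mat_eq falling_op_proj_sum[OF assms] by (auto simp: terwilliger_simps)

lemma falling_op_zero:
  assumes "q > 0"
  shows "falling_op (site_op q D zero_loc) m f x = (\<Prod>j<m. of_nat (hzeros D x) - of_nat j) * f x"
  by (induction m) (simp_all add: site_op_zero[OF assms] algebra_simps)

text \<open>At a vertex with \<open>j\<close> zeros, where \<open>j \<le> D\<close>, the factor with
  index \<open>j\<close> vanishes.\<close>

lemma falling_mat_zero:
  assumes "q \<ge> 2"
  shows "falling_mat q D zero_loc (Suc D) = \<zero>\<^bsub>terwilliger_algebra q D\<^esub>"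
proof -
  have "(\<Prod>j<Suc D. of_nat (hzeros D x) - of_nat j) = (0::complex)" for x
    using hzeros_le[of D x] by (intro prod_zero bexI[of _ "hzeros D x"]) auto
  then have *: "falling_op (site_op q D zero_loc) (Suc D) f x = 0" for f x
    using assms by (simp only: falling_op_zero mult_zero_left)
  show ?thesis by (simp only: falling_mat_eq terwilliger_simps * if_cancel)
qed

section \<open>Modules and lowest weight vectors\<close>

locale hamming_module = left_module "terwilliger_algebra q D" V
  for q D :: nat and V :: "'v tmodule" (structure) +
  assumes q_ge: "3 \<le> q"
begin

abbreviation T where "T \<equiv> terwilliger_algebra q D"

abbreviation cs :: "complex \<Rightarrow> 'v \<Rightarrow> 'v" (infixr "\<cdot>" 75) where
  "c \<cdot> x \<equiv> cscale (hvertices q D) V c x"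

abbreviation act :: "(nat \<Rightarrow> nat \<Rightarrow> complex) \<Rightarrow> 'v \<Rightarrow> 'v" where
  "act M x \<equiv> site_mat q D M \<odot>\<^bsub>V\<^esub> x"

lemma cs_closed [simp]: "x \<in> carrier V \<Longrightarrow> c \<cdot> x \<in> carrier V"
  by (simp add: cscale_def smult_closed)

lemma scalar_add:
  "scalar_cmat (hvertices q D) (c + d) = scalar_cmat (hvertices q D) c \<oplus>\<^bsub>T\<^esub> scalar_cmat (hvertices q D) d"
  by (auto simp: terwilliger_simps scalar_cmat_apply intro!: ext)

lemma scalar_mult:
  "scalar_cmat (hvertices q D) (c * d) = scalar_cmat (hvertices q D) c \<otimes>\<^bsub>T\<^esub> scalar_cmat (hvertices q D) d"
  by (auto simp: terwilliger_simps sum_scalar_cmat_left intro!: ext) (auto simp: scalar_cmat_apply)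

lemma cs_add_left: "x \<in> carrier V \<Longrightarrow> (c + d) \<cdot> x = c \<cdot> x \<oplus>\<^bsub>V\<^esub> d \<cdot> x"
  by (simp add: cscale_def scalar_add smult_l_distr)

lemma cs_add_right: "x \<in> carrier V \<Longrightarrow> y \<in> carrier V \<Longrightarrow> c \<cdot> (x \<oplus>\<^bsub>V\<^esub> y) = c \<cdot> x \<oplus>\<^bsub>V\<^esub> c \<cdot> y"
  by (simp add: cscale_def smult_r_distr)

lemma cs_cs [simp]: "x \<in> carrier V \<Longrightarrow> c \<cdot> d \<cdot> x = (c * d) \<cdot> x"
  by (simp add: cscale_def scalar_mult smult_assoc)

lemma cs_one [simp]: "x \<in> carrier V \<Longrightarrow> 1 \<cdot> x = x"
  using smult_one by (simp add: cscale_def terwilliger_simps)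

lemma smult_zero_right [simp]: "a \<in> carrier T \<Longrightarrow> a \<odot>\<^bsub>V\<^esub> \<zero>\<^bsub>V\<^esub> = \<zero>\<^bsub>V\<^esub>"
  using smult_r_distr[of a "\<zero>\<^bsub>V\<^esub>" "\<zero>\<^bsub>V\<^esub>"] smult_closed[of a "\<zero>\<^bsub>V\<^esub>"] by simp

lemma smult_zero_left [simp]: "x \<in> carrier V \<Longrightarrow> \<zero>\<^bsub>T\<^esub> \<odot>\<^bsub>V\<^esub> x = \<zero>\<^bsub>V\<^esub>"
  using smult_l_distr[of "\<zero>\<^bsub>T\<^esub>" "\<zero>\<^bsub>T\<^esub>" x] smult_closed[of "\<zero>\<^bsub>T\<^esub>" x] by simp

lemma cs_zero_right [simp]: "c \<cdot> \<zero>\<^bsub>V\<^esub> = \<zero>\<^bsub>V\<^esub>"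
  by (simp add: cscale_def)

lemma scalar_zero: "scalar_cmat (hvertices q D) 0 = \<zero>\<^bsub>T\<^esub>"
  by (auto simp: terwilliger_simps scalar_cmat_apply intro!: ext)

lemma cs_zero_left [simp]: "x \<in> carrier V \<Longrightarrow> 0 \<cdot> x = \<zero>\<^bsub>V\<^esub>"
  by (simp add: cscale_def scalar_zero)

lemma cs_eq_zero_iff:
  assumes "x \<in> carrier V"
  shows "c \<cdot> x = \<zero>\<^bsub>V\<^esub> \<longleftrightarrow> c = 0 \<or> x = \<zero>\<^bsub>V\<^esub>"
proof
  assume *: "c \<cdot> x = \<zero>\<^bsub>V\<^esub>"
  have "x = (inverse c) \<cdot> c \<cdot> x" if "c \<noteq> 0" using that assms by simp
  then show "c = 0 \<or> x = \<zero>\<^bsub>V\<^esub>" unfolding * by auto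
qed (use assms in auto)

lemma cs_minus: "x \<in> carrier V \<Longrightarrow> \<ominus>\<^bsub>V\<^esub> x = (-1) \<cdot> x"
  using cs_add_left[of x "-1" 1] by (intro M.minus_equality) auto

text \<open>Scalar matrices commute with every matrix supported on the vertices, so the algebra acts
  by complex linear maps.\<close>

lemma smult_cs:
  assumes "a \<in> carrier T" "x \<in> carrier V"
  shows "a \<odot>\<^bsub>V\<^esub> (c \<cdot> x) = c \<cdot> (a \<odot>\<^bsub>V\<^esub> x)"
proof -
  have "a x y = 0" if "x \<notin> hvertices q D \<or> y \<notin> hvertices q D" for x y
    using terwilliger_in_cmat[OF assms(1)] that by auto
  then have "a \<otimes>\<^bsub>T\<^esub> scalar_cmat (hvertices q D) c = scalar_cmat (hvertices q D) c \<otimes>\<^bsub>T\<^esub> a"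
    by (auto simp: terwilliger_simps sum_scalar_cmat_left sum_scalar_cmat_right intro!: ext)
  then show ?thesis
    using smult_assoc[OF assms(1) scalar_in_terwilliger assms(2), of c]
      smult_assoc[OF scalar_in_terwilliger assms, of c]
    by (simp add: cscale_def)
qed

lemma q2: "2 \<le> q" and q_nz: "of_nat q - 1 \<noteq> (0::complex)"
proof -
  show "2 \<le> q" using q_ge by simp
  then show "of_nat q - 1 \<noteq> (0::complex)" by (rule of_nat_diff_one_nonzero)
qed

lemma site_algebra [simp]: "delta_loc \<in> site_algebra q D" "zero_loc \<in> site_algebra q D" "adj_loc \<in> site_algebra q D"
    "lower_loc \<in> site_algebra q D" "raise_loc \<in> site_algebra q D" "proj_loc q \<in> site_algebra q D"
  using site_algebra_members[OF q2] by auto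

lemma site_algebraD: "M \<in> site_algebra q D \<Longrightarrow> site_mat q D M \<in> carrier T"
  by (simp add: site_algebra_def)

lemma act_closed [simp]: "M \<in> site_algebra q D \<Longrightarrow> x \<in> carrier V \<Longrightarrow> act M x \<in> carrier V"
  by (simp add: site_algebraD smult_closed)

lemma act_zero [simp]: "M \<in> site_algebra q D \<Longrightarrow> act M \<zero>\<^bsub>V\<^esub> = \<zero>\<^bsub>V\<^esub>"
  by (simp add: site_algebraD)

lemma act_cs: "M \<in> site_algebra q D \<Longrightarrow> x \<in> carrier V \<Longrightarrow> act M (c \<cdot> x) = c \<cdot> act M x"
  by (simp add: site_algebraD smult_cs)

lemma act_add:
  "M \<in> site_algebra q D \<Longrightarrow> N \<in> site_algebra q D \<Longrightarrow> x \<in> carrier V \<Longrightarrow>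
    act (\<lambda>a b. M a b + N a b) x = act M x \<oplus>\<^bsub>V\<^esub> act N x"
  unfolding site_mat_add terwilliger_simps(2)[symmetric] by (simp add: site_algebraD smult_l_distr)

lemma act_cmult:
  "M \<in> site_algebra q D \<Longrightarrow> x \<in> carrier V \<Longrightarrow> act (\<lambda>a b. c * M a b) x = c \<cdot> act M x"
  unfolding site_mat_cmult terwilliger_simps(1)[symmetric] by (simp add: site_algebraD smult_assoc cscale_def)

lemma act_commutator:
  assumes "M \<in> site_algebra q D" "N \<in> site_algebra q D" "x \<in> carrier V"
    "\<And>a b. loc_mult q M N a b = loc_mult q N M a b + K a b"
  shows "act M (act N x) = act N (act M x) \<oplus>\<^bsub>V\<^esub> act K x"
proof -
  have K: "K \<in> site_algebra q D" by (rule site_algebra_commutator[OF assms(1,2,4)])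
  have "act M (act N x) = (site_mat q D M \<otimes>\<^bsub>T\<^esub> site_mat q D N) \<odot>\<^bsub>V\<^esub> x"
    using assms by (simp add: site_algebraD smult_assoc)
  also have "site_mat q D M \<otimes>\<^bsub>T\<^esub> site_mat q D N = site_mat q D N \<otimes>\<^bsub>T\<^esub> site_mat q D M \<oplus>\<^bsub>T\<^esub> site_mat q D K"
    unfolding terwilliger_simps by (rule site_mat_commutator[OF assms(4)])
  finally show ?thesis
    using assms K by (simp add: site_algebraD smult_assoc smult_l_distr)
qed

lemma act_delta: "x \<in> carrier V \<Longrightarrow> act delta_loc x = of_nat D \<cdot> x"
  by (simp add: cscale_def scalar_cmat_eq_site_mat)

lemma adj_act: "adj_mat q D \<odot>\<^bsub>V\<^esub> x = act adj_loc x"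
  by (simp add: adj_mat_eq_site_mat)

lemma adj_act_eq:
  assumes "x \<in> carrier V"
  shows "adj_mat q D \<odot>\<^bsub>V\<^esub> x = (act lower_loc x \<oplus>\<^bsub>V\<^esub> act raise_loc x) \<oplus>\<^bsub>V\<^esub>
    ((of_nat q - 1) \<cdot> act (proj_loc q) x \<oplus>\<^bsub>V\<^esub> ((2 - of_nat q) \<cdot> act zero_loc x \<oplus>\<^bsub>V\<^esub> (- of_nat D) \<cdot> x))"
proof -
  \<comment> \<open>The decomposition is regrouped without subtraction, since \<open>act_add\<close>
    and \<open>act_cmult\<close> match sums and scalar multiples.\<close>
  have *: "adj_loc = (\<lambda>a b. (lower_loc a b + raise_loc a b) + ((of_nat q - 1) * proj_loc q a b
      + ((2 - of_nat q) * zero_loc a b + (-1) * delta_loc a b)))"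
    by (intro ext) (simp add: adj_loc_eq[OF q2] algebra_simps)
  show ?thesis
    unfolding adj_act by (subst *)
      (simp only: assms act_add act_cmult site_algebra site_algebra_add site_algebra_cmult act_delta, simp only: assms cs_cs mult_minus1)
qed

lemma dual_act:
  assumes "x \<in> carrier V"
  shows "dual_adj_mat q D \<odot>\<^bsub>V\<^esub> x = of_nat q \<cdot> act zero_loc x \<oplus>\<^bsub>V\<^esub> (- of_nat D) \<cdot> x"
proof -
  have "dual_adj_mat q D = site_mat q D (\<lambda>a b. of_nat q * zero_loc a b + (-1) * delta_loc a b)"
    using q_ge by (intro dual_adj_mat_eq_site_mat) simp
  then show ?thesis
    using assms by (simp only: act_add act_cmult site_algebra site_algebra_cmult act_delta) (simp only: cs_cs mult_minus1)
qed

text \<open>By \<open>terwilliger_induct\<close>, closure under the two generators and under scalars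
  suffices; negatives are multiples by -1.\<close>

lemma submoduleI:
  assumes "H \<subseteq> carrier V" "\<zero>\<^bsub>V\<^esub> \<in> H" "\<And>x y. x \<in> H \<Longrightarrow> y \<in> H \<Longrightarrow> x \<oplus>\<^bsub>V\<^esub> y \<in> H"
    "\<And>c x. x \<in> H \<Longrightarrow> c \<cdot> x \<in> H"
    "\<And>x. x \<in> H \<Longrightarrow> adj_mat q D \<odot>\<^bsub>V\<^esub> x \<in> H" "\<And>x. x \<in> H \<Longrightarrow> dual_adj_mat q D \<odot>\<^bsub>V\<^esub> x \<in> H"
  shows "submodule H T V"
proof -
  have "\<forall>x\<in>H. a \<odot>\<^bsub>V\<^esub> x \<in> H" if "a \<in> carrier T" for a
    using that
  proof (induction a rule: terwilliger_induct)
    case (scalar c)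
    then show ?case using assms(4)[of _ c] by (simp add: cscale_def)
  next
    case (add a b)
    then show ?case using assms(1,3) by (auto simp: smult_l_distr)
  next
    case (mult a b)
    then show ?case using assms(1) by (auto simp: smult_assoc subset_iff)
  qed (use assms in auto)
  moreover have "subgroup H (add_monoid V)"
  proof (rule M.add.subgroupI)
    fix x assume x: "x \<in> H"
    then have "\<ominus>\<^bsub>V\<^esub> x = (-1) \<cdot> x" using assms(1) by (intro cs_minus) auto
    then show "\<ominus>\<^bsub>V\<^esub> x \<in> H" using assms(4)[OF x, of "-1"] by simp
  qed (use assms in auto)
  ultimately show ?thesis
    unfolding submodule_def submodule_axioms_def by auto
qed

lemma submoduleD:
  assumes "submodule H T V"
  shows "H \<subseteq> carrier V" "\<zero>\<^bsub>V\<^esub> \<in> H" "\<And>x y. x \<in> H \<Longrightarrow> y \<in> H \<Longrightarrow> x \<oplus>\<^bsub>V\<^esub> y \<in> H"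
    "\<And>x. x \<in> H \<Longrightarrow> \<ominus>\<^bsub>V\<^esub> x \<in> H" "\<And>c x. x \<in> H \<Longrightarrow> c \<cdot> x \<in> H"
    "\<And>a x. a \<in> carrier T \<Longrightarrow> x \<in> H \<Longrightarrow> a \<odot>\<^bsub>V\<^esub> x \<in> H"
proof -
  interpret H: submodule H T V by fact
  show "H \<subseteq> carrier V" "\<zero>\<^bsub>V\<^esub> \<in> H" "\<And>x y. x \<in> H \<Longrightarrow> y \<in> H \<Longrightarrow> x \<oplus>\<^bsub>V\<^esub> y \<in> H"
    using H.subset H.one_closed H.m_closed by auto
  show "\<And>x. x \<in> H \<Longrightarrow> \<ominus>\<^bsub>V\<^esub> x \<in> H"
    using H.m_inv_closed by (auto simp: a_inv_def)
  show sm: "\<And>a x. a \<in> carrier T \<Longrightarrow> x \<in> H \<Longrightarrow> a \<odot>\<^bsub>V\<^esub> x \<in> H"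
    by (rule H.smult_closed)
  show "\<And>c x. x \<in> H \<Longrightarrow> c \<cdot> x \<in> H"
    by (simp add: cscale_def sm)
qed

lemma submodule_zero: "submodule {\<zero>\<^bsub>V\<^esub>} T V"
  by (rule submoduleI) auto

section \<open>Eigenvectors and commutation relations on a module\<close>

lemma falling_step:
  assumes "M \<in> site_algebra q D" "x \<in> carrier V"
  shows "falling_mat q D M (Suc m) \<odot>\<^bsub>V\<^esub> x
    = act M (falling_mat q D M m \<odot>\<^bsub>V\<^esub> x) \<oplus>\<^bsub>V\<^esub> (- of_nat m) \<cdot> (falling_mat q D M m \<odot>\<^bsub>V\<^esub> x)"
  using assms by (simp add: falling_mat_closed smult_l_distr smult_assoc site_algebraD cscale_def)

text \<open>The factors \<open>M\<close>, \<open>M - 1\<close>, \<dots>, \<open>M - D\<close> are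
  applied to \<open>x\<close> one after the other; the vector just before the first zero is an
  eigenvector.\<close>

lemma eigenvector_exists:
  assumes M: "M \<in> site_algebra q D" "falling_mat q D M (Suc D) = \<zero>\<^bsub>T\<^esub>"
    and x: "x \<in> carrier V" "x \<noteq> \<zero>\<^bsub>V\<^esub>"
  obtains j y where "j \<le> D" "y \<in> carrier V" "y \<noteq> \<zero>\<^bsub>V\<^esub>" "act M y = of_nat j \<cdot> y"
proof -
  define f where "f m = falling_mat q D M m \<odot>\<^bsub>V\<^esub> x" for m
  have f: "f m \<in> carrier V" for m
    using M x by (simp add: f_def smult_closed falling_mat_closed)
  have "f (Suc D) = \<zero>\<^bsub>V\<^esub>" using M x by (simp add: f_def del: falling_mat.simps)
  moreover have "f 0 \<noteq> \<zero>\<^bsub>V\<^esub>" using x smult_one by (simp add: f_def)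
  ultimately obtain j where j: "j < Suc D" "\<forall>i\<le>j. f i \<noteq> \<zero>\<^bsub>V\<^esub>" "f (Suc j) = \<zero>\<^bsub>V\<^esub>"
    using ex_least_nat_less[of "\<lambda>m. f m = \<zero>\<^bsub>V\<^esub>" "Suc D"] by auto
  have "act M (f j) \<oplus>\<^bsub>V\<^esub> (- of_nat j) \<cdot> f j = \<zero>\<^bsub>V\<^esub>"
    using j(3) falling_step[OF M(1) x(1), of j] by (simp add: f_def)
  moreover have "of_nat j \<cdot> f j \<oplus>\<^bsub>V\<^esub> (- of_nat j) \<cdot> f j = \<zero>\<^bsub>V\<^esub>"
    using cs_add_left[of "f j" "of_nat j" "- of_nat j"] f by simp
  ultimately have "act M (f j) = of_nat j \<cdot> f j"
    using f M by (metis M.add.right_cancel act_closed cs_closed)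
  then show thesis using that[of j "f j"] j f by auto
qed

text \<open>On an eigenvector for \<open>c\<close> the annihilating polynomial acts as the product
  of the numbers \<open>c - j\<close> with \<open>j \<le> D\<close>, so one of them
  vanishes.\<close>

lemma eigenvalue_nat:
  assumes M: "M \<in> site_algebra q D" "falling_mat q D M (Suc D) = \<zero>\<^bsub>T\<^esub>"
    and x: "x \<in> carrier V" "x \<noteq> \<zero>\<^bsub>V\<^esub>" "act M x = c \<cdot> x"
  obtains j where "j \<le> D" "c = of_nat j"
proof -
  have "falling_mat q D M m \<odot>\<^bsub>V\<^esub> x = (\<Prod>j<m. c - of_nat j) \<cdot> x" for m
  proof (induction m)
    case 0
    then show ?case using smult_one x by simp
  next
    case (Suc m)
    then show ?case
      unfolding falling_step[OF M(1) x(1)]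
      using x M(1) by (simp add: act_cs cs_add_left[symmetric] algebra_simps)
  qed
  then have "(\<Prod>j<Suc D. c - of_nat j) \<cdot> x = \<zero>\<^bsub>V\<^esub>"
    using M(2) x by (metis smult_zero_left)
  then have "(\<Prod>j<Suc D. c - of_nat j) = 0"
    using x by (simp only: cs_eq_zero_iff) auto
  then show thesis using that by (auto simp: less_Suc_eq_le simp del: prod.lessThan_Suc)
qed

lemmas zero_eigenvector = eigenvector_exists[OF site_algebra(2) falling_mat_zero[OF q2]]
lemmas zero_eigenvalue = eigenvalue_nat[OF site_algebra(2) falling_mat_zero[OF q2]]
lemmas proj_eigenvector = eigenvector_exists[OF site_algebra(6) falling_mat_proj[OF q2]]

lemma zero_lower:
  "x \<in> carrier V \<Longrightarrow> act zero_loc (act lower_loc x) = act lower_loc (act zero_loc x) \<oplus>\<^bsub>V\<^esub> act lower_loc x"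
  by (rule act_commutator[OF _ _ _ loc_relations(2)[OF q2]]) auto

lemma zero_raise:
  "x \<in> carrier V \<Longrightarrow> act zero_loc (act raise_loc x) = act raise_loc (act zero_loc x) \<oplus>\<^bsub>V\<^esub> (-1) \<cdot> act raise_loc x"
  using act_commutator[OF _ _ _ loc_relations(3)[OF q2], of x] by (simp only: site_algebra act_cmult)

lemma lower_raise:
  assumes "x \<in> carrier V"
  shows "act lower_loc (act raise_loc x) = act raise_loc (act lower_loc x)
    \<oplus>\<^bsub>V\<^esub> (of_nat q - 1) \<cdot> (2 \<cdot> act zero_loc x \<oplus>\<^bsub>V\<^esub> (-1) \<cdot> act (proj_loc q) x)"
proof -
  have "act (\<lambda>a b. (of_nat q - 1) * (2 * zero_loc a b + (-1) * proj_loc q a b)) x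
      = (of_nat q - 1) \<cdot> (2 \<cdot> act zero_loc x \<oplus>\<^bsub>V\<^esub> (-1) \<cdot> act (proj_loc q) x)"
    using assms by (simp only: act_cmult[OF site_algebra_add[OF site_algebra_cmult site_algebra_cmult]] act_add[OF site_algebra_cmult site_algebra_cmult] act_cmult site_algebra)
  then show ?thesis
    using act_commutator[OF _ _ assms loc_relations(4)[OF q2]] by simp
qed

lemma proj_commute:
  assumes "x \<in> carrier V"
  shows "act (proj_loc q) (act lower_loc x) = act lower_loc (act (proj_loc q) x)"
    "act (proj_loc q) (act raise_loc x) = act raise_loc (act (proj_loc q) x)"
    "act (proj_loc q) (act zero_loc x) = act zero_loc (act (proj_loc q) x)"
  using act_commutator[OF _ _ assms loc_relations(5)[OF q2]] act_commutator[OF _ _ assms loc_relations(6)[OF q2]]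
    act_commutator[OF _ _ assms loc_relations(7)[OF q2]] assms
  by (simp_all only: site_algebra act_cmult) simp_all

text \<open>\<open>N\<close> commutes with \<open>L\<close>, \<open>R\<close> and \<open>Z\<close>,
  hence with \<open>A\<close> and \<open>A\<^sup>*\<close>. In an irreducible module a nonzero
  eigenspace is therefore everything, which is how Schur's lemma enters.\<close>

lemma proj_eigenspace_submodule: "submodule {x \<in> carrier V. act (proj_loc q) x = c \<cdot> x} T V"
proof (rule submoduleI)
  fix x assume "x \<in> {x \<in> carrier V. act (proj_loc q) x = c \<cdot> x}"
  then have x: "x \<in> carrier V" and e: "act (proj_loc q) x = c \<cdot> x" by auto
  note P = site_algebraD[OF site_algebra(6)]
  note lin = smult_r_distr[OF P] act_cs[OF site_algebra(6)] cs_add_right proj_commute[OF x]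
  show "adj_mat q D \<odot>\<^bsub>V\<^esub> x \<in> {x \<in> carrier V. act (proj_loc q) x = c \<cdot> x}"
    using x by (simp add: smult_closed) (simp add: adj_act_eq lin e act_cs mult.commute)
  show "dual_adj_mat q D \<odot>\<^bsub>V\<^esub> x \<in> {x \<in> carrier V. act (proj_loc q) x = c \<cdot> x}"
    using x by (simp add: smult_closed) (simp add: dual_act lin e act_cs mult.commute)
qed (auto simp: smult_r_distr[OF site_algebraD] act_cs cs_add_right mult.commute)

lemma finsum_act:
  assumes "a \<in> carrier T" "finite A" "f \<in> A \<rightarrow> carrier V"
  shows "a \<odot>\<^bsub>V\<^esub> (\<Oplus>\<^bsub>V\<^esub>i\<in>A. f i) = (\<Oplus>\<^bsub>V\<^esub>i\<in>A. a \<odot>\<^bsub>V\<^esub> f i)"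
  using assms(2,3)
proof (induction A)
  case (insert i A)
  then have "f \<in> A \<rightarrow> carrier V" "(\<lambda>i. a \<odot>\<^bsub>V\<^esub> f i) \<in> A \<rightarrow> carrier V" "f i \<in> carrier V"
    using assms(1) by (auto intro!: smult_closed)
  then show ?case
    using insert assms(1) by (simp add: M.finsum_insert smult_r_distr smult_closed M.finsum_closed)
qed (use assms in simp)

lemma finsum_mem:
  assumes "\<zero>\<^bsub>V\<^esub> \<in> H" "\<And>x y. x \<in> H \<Longrightarrow> y \<in> H \<Longrightarrow> x \<oplus>\<^bsub>V\<^esub> y \<in> H" "H \<subseteq> carrier V"
    and "finite A" "f \<in> A \<rightarrow> H"
  shows "(\<Oplus>\<^bsub>V\<^esub>i\<in>A. f i) \<in> H"
  using assms(4,5)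
proof (induction A)
  case (insert i A)
  then have "f \<in> A \<rightarrow> carrier V" "f i \<in> carrier V" using assms(3) by auto
  then show ?case using insert assms(2) by (simp add: M.finsum_insert)
qed (use assms in simp)

lemma finsum_delta:
  assumes "finite A" "u k \<in> carrier V" "u \<in> A \<rightarrow> carrier V"
  shows "(\<Oplus>\<^bsub>V\<^esub>i\<in>A. (if i = k then c else 0) \<cdot> u i) = (if k \<in> A then c \<cdot> u k else \<zero>\<^bsub>V\<^esub>)"
proof -
  have "(\<Oplus>\<^bsub>V\<^esub>i\<in>A. (if i = k then c else 0) \<cdot> u i) = (\<Oplus>\<^bsub>V\<^esub>i\<in>A. if k = i then c \<cdot> u i else \<zero>\<^bsub>V\<^esub>)"
    using assms by (intro M.finsum_cong') (auto simp: Pi_iff)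
  also have "\<dots> = (if k \<in> A then c \<cdot> u k else \<zero>\<^bsub>V\<^esub>)"
  proof (cases "k \<in> A")
    case True
    have "(\<lambda>i. c \<cdot> u i) \<in> A \<rightarrow> carrier V" using assms by (auto simp: Pi_iff)
    from M.finsum_singleton[OF True assms(1) this] True show ?thesis by simp
  next
    case False
    then have "(\<Oplus>\<^bsub>V\<^esub>i\<in>A. if k = i then c \<cdot> u i else \<zero>\<^bsub>V\<^esub>) = (\<Oplus>\<^bsub>V\<^esub>i\<in>A. \<zero>\<^bsub>V\<^esub>)"
      by (intro M.finsum_cong') auto
    then show ?thesis using False by simp
  qed
  finally show ?thesis .
qed

end

section \<open>The chain generated by a lowest weight vector\<close>

text \<open>The setting covers both an irreducible module and the standard module, which is
  reducible in general. Since \<open>L\<close> raises the eigenvalue of \<open>Z\<close>, the vector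
  \<open>x\<close> sits at the top of the \<open>Z\<close>-spectrum of its chain.\<close>

locale weight_chain = hamming_module +
  fixes x and p z :: nat
  assumes x: "x \<in> carrier V" "x \<noteq> \<zero>\<^bsub>V\<^esub>"
    and lower_x: "act lower_loc x = \<zero>\<^bsub>V\<^esub>"
    and zero_x: "act zero_loc x = of_nat z \<cdot> x"
    and proj_x: "act (proj_loc q) x = of_nat p \<cdot> x"
begin

declare x(1) [simp]

text \<open>The divided powers \<open>R\<^sup>i x / i!\<close>; this normalisation makes
  \<open>R\<close> act with the coefficients \<open>i + 1\<close>, the entries
  \<open>L_beta\<close>.\<close>

primrec u :: "nat \<Rightarrow> 'a" where
  "u 0 = x"
| "u (Suc i) = (1 / of_nat (Suc i)) \<cdot> act raise_loc (u i)"

lemma u_closed [simp]: "u i \<in> carrier V"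
  by (induction i) (simp_all add: x)

lemma raise_u: "act raise_loc (u i) = of_nat (Suc i) \<cdot> u (Suc i)"
  by (simp del: of_nat_Suc)

lemma zero_u: "act zero_loc (u i) = (of_nat z - of_nat i) \<cdot> u i"
proof (induction i)
  case (Suc i)
  have "act zero_loc (u (Suc i)) = (1 / of_nat (Suc i)) \<cdot>
      ((of_nat z - of_nat i) \<cdot> act raise_loc (u i) \<oplus>\<^bsub>V\<^esub> (-1) \<cdot> act raise_loc (u i))"
    by (simp add: act_cs zero_raise Suc.IH del: of_nat_Suc)
  also have "\<dots> = (of_nat z - of_nat (Suc i)) \<cdot> u (Suc i)"
    unfolding cs_add_left[OF act_closed[OF site_algebra(5) u_closed], symmetric]
    by (simp add: algebra_simps)
  finally show ?case .
qed (simp add: zero_x)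

lemma proj_u: "act (proj_loc q) (u i) = of_nat p \<cdot> u i"
  by (induction i) (simp_all add: proj_x act_cs proj_commute mult.commute)

text \<open>With \<open>k = p - z\<close> this is the entry \<open>L_gamma\<close> at index
  \<open>i + 1\<close>, see \<open>gamma_eq\<close>.\<close>

definition lowering_coeff :: "nat \<Rightarrow> complex" where
  "lowering_coeff i = (of_nat q - 1) * (2 * of_nat z - of_nat p - of_nat i)"

text \<open>Moving \<open>L\<close> past \<open>R\<close> gives, for the coefficients
  \<open>c\<close>, the recursion \<open>(i + 2) c (i + 1) = (i + 1) c i + (q - 1) (2 (z - i - 1) -
  p)\<close>, which \<open>lowering_coeff\<close> solves.\<close>

lemma lower_u: "act lower_loc (u (Suc i)) = lowering_coeff i \<cdot> u i"
proof (induction i)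
  case 0
  show ?case
    using x by (simp add: lower_raise lower_x zero_x proj_x cs_add_left[symmetric] lowering_coeff_def)
next
  case (Suc i)
  let ?v = "u (Suc i)"
  have "act lower_loc (u (Suc (Suc i))) = (1 / of_nat (Suc (Suc i))) \<cdot> act lower_loc (act raise_loc ?v)"
    by (simp only: u.simps(2)[of "Suc i"] act_cs site_algebra act_closed u_closed)
  also have "act lower_loc (act raise_loc ?v)
      = act raise_loc (act lower_loc ?v) \<oplus>\<^bsub>V\<^esub> (of_nat q - 1) \<cdot> (2 \<cdot> act zero_loc ?v \<oplus>\<^bsub>V\<^esub> (-1) \<cdot> act (proj_loc q) ?v)"
    by (rule lower_raise) simp
  also have "act raise_loc (act lower_loc ?v) = lowering_coeff i \<cdot> of_nat (Suc i) \<cdot> ?v"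
    unfolding Suc.IH act_cs[OF site_algebra(5) u_closed] raise_u ..
  also have "(of_nat q - 1) \<cdot> (2 \<cdot> act zero_loc ?v \<oplus>\<^bsub>V\<^esub> (-1) \<cdot> act (proj_loc q) ?v)
      = ((of_nat q - 1) * (2 * (of_nat z - of_nat (Suc i)) - of_nat p)) \<cdot> ?v"
    unfolding zero_u proj_u cs_cs[OF u_closed] cs_add_left[OF u_closed, symmetric] by simp
  finally have *: "act lower_loc (u (Suc (Suc i)))
      = (1 / of_nat (Suc (Suc i)) * (lowering_coeff i * of_nat (Suc i) + (of_nat q - 1) * (2 * (of_nat z - of_nat (Suc i)) - of_nat p))) \<cdot> ?v"
    by (simp only: cs_cs u_closed cs_add_left[symmetric])
  have nz: "of_nat (Suc (Suc i)) \<noteq> (0::complex)" by (rule of_nat_neq_0)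
  have "lowering_coeff i * of_nat (Suc i) + (of_nat q - 1) * (2 * (of_nat z - of_nat (Suc i)) - of_nat p)
      = of_nat (Suc (Suc i)) * lowering_coeff (Suc i)"
    by (simp add: lowering_coeff_def algebra_simps)
  then have e: "1 / of_nat (Suc (Suc i)) * (lowering_coeff i * of_nat (Suc i) + (of_nat q - 1) * (2 * (of_nat z - of_nat (Suc i)) - of_nat p))
      = lowering_coeff (Suc i)"
    using nz by (simp del: of_nat_Suc)
  show ?case unfolding * e ..
qed

text \<open>The next vector of the chain would be an eigenvector of \<open>Z\<close> for the eigenvalue \<open>-1\<close>.\<close>

lemma u_eventually_zero: "u (Suc z) = \<zero>\<^bsub>V\<^esub>"
proof (rule ccontr)
  assume nz: "u (Suc z) \<noteq> \<zero>\<^bsub>V\<^esub>"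
  have "act zero_loc (u (Suc z)) = (-1) \<cdot> u (Suc z)"
    unfolding zero_u by simp
  then obtain j where j: "- 1 = (of_nat j :: complex)"
    using zero_eigenvalue[OF u_closed nz] by metis
  then have "(of_nat (Suc j) :: complex) = 0" by (simp flip: j)
  then show False by (simp del: of_nat_Suc)
qed

text \<open>If \<open>u (Suc n)\<close> is the first zero vector, applying \<open>L\<close> to it
  gives \<open>lowering_coeff n = 0\<close>, that is, \<open>n = 2 z - p\<close>. The bound
  \<open>n \<le> z\<close> comes from \<open>u_eventually_zero\<close>.\<close>

lemma chain_length:
  obtains n where "n \<le> z" "2 * z = p + n" "u (Suc n) = \<zero>\<^bsub>V\<^esub>" "\<And>i. i \<le> n \<Longrightarrow> u i \<noteq> \<zero>\<^bsub>V\<^esub>"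
proof -
  obtain n where n: "n < Suc z" "\<forall>i\<le>n. u i \<noteq> \<zero>\<^bsub>V\<^esub>" "u (Suc n) = \<zero>\<^bsub>V\<^esub>"
    using ex_least_nat_less[of "\<lambda>m. u m = \<zero>\<^bsub>V\<^esub>" "Suc z"] u_eventually_zero x by auto
  have "lowering_coeff n \<cdot> u n = \<zero>\<^bsub>V\<^esub>"
    using lower_u[of n] n(3) by simp
  then have "lowering_coeff n = 0" using n(2) by (simp add: cs_eq_zero_iff)
  then have "2 * of_nat z - of_nat p - of_nat n = (0::complex)"
    using q_nz by (simp add: lowering_coeff_def)
  then have "(of_nat (2 * z) :: complex) = of_nat (p + n)"
    by (simp add: algebra_simps)
  then have "2 * z = p + n" unfolding of_nat_eq_iff .
  then show thesis using n by (intro that[of n]) auto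
qed

text \<open>From \<open>2 z = p + n\<close> and \<open>n \<le> z\<close>. It makes
  \<open>k = p - z\<close> a true difference of natural numbers.\<close>

lemma z_le_p: "z \<le> p"
  by (rule chain_length) simp

definition len :: nat where "len = 2 * z - p"

lemma len: "2 * z = p + len" "u (Suc len) = \<zero>\<^bsub>V\<^esub>" "i \<le> len \<Longrightarrow> u i \<noteq> \<zero>\<^bsub>V\<^esub>"
proof -
  obtain n where n: "2 * z = p + n" "u (Suc n) = \<zero>\<^bsub>V\<^esub>" "\<And>i. i \<le> n \<Longrightarrow> u i \<noteq> \<zero>\<^bsub>V\<^esub>"
    using chain_length by blast
  then have "n = len" by (simp add: len_def)
  with n show "2 * z = p + len" "u (Suc len) = \<zero>\<^bsub>V\<^esub>" "i \<le> len \<Longrightarrow> u i \<noteq> \<zero>\<^bsub>V\<^esub>" by auto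
qed

lemma lowering_coeff_nonzero: "i < len \<Longrightarrow> lowering_coeff i \<noteq> 0"
proof
  assume "i < len" "lowering_coeff i = 0"
  then have "2 * of_nat z - of_nat p - of_nat i = (0::complex)"
    using q_nz by (simp add: lowering_coeff_def)
  then have "(of_nat (2 * z) :: complex) = of_nat (p + i)"
    by (simp add: algebra_simps)
  then have "2 * z = p + i" unfolding of_nat_eq_iff .
  with \<open>i < len\<close> len(1) show False by simp
qed

definition comb :: "(nat \<Rightarrow> complex) \<Rightarrow> nat \<Rightarrow> 'a" where
  "comb c m = (\<Oplus>\<^bsub>V\<^esub>i\<in>{..m}. c i \<cdot> u i)"

lemma comb_closed [simp]: "comb c m \<in> carrier V"
  unfolding comb_def by (intro M.finsum_closed) auto

lemma comb_Suc: "comb c (Suc m) = c (Suc m) \<cdot> u (Suc m) \<oplus>\<^bsub>V\<^esub> comb c m"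
  unfolding comb_def by (rule M.finsum_Suc) auto

lemma comb_add: "comb c m \<oplus>\<^bsub>V\<^esub> comb d m = comb (\<lambda>i. c i + d i) m"
  unfolding comb_def by (subst M.finsum_addf[symmetric]) (auto simp: cs_add_left)

lemma smult_comb:
  assumes "a \<in> carrier T"
  shows "a \<odot>\<^bsub>V\<^esub> comb c m = (\<Oplus>\<^bsub>V\<^esub>i\<in>{..m}. c i \<cdot> (a \<odot>\<^bsub>V\<^esub> u i))"
  unfolding comb_def using assms by (subst finsum_act) (auto simp: smult_cs)

lemma cs_comb: "d \<cdot> comb c m = comb (\<lambda>i. d * c i) m"
proof -
  have "d \<cdot> comb c m = (\<Oplus>\<^bsub>V\<^esub>i\<in>{..m}. c i \<cdot> (d \<cdot> u i))"
    unfolding cscale_def[of _ _ d] by (rule smult_comb) simp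
  then show ?thesis by (simp add: comb_def mult.commute)
qed

lemma comb_zero: "comb (\<lambda>_. 0) m = \<zero>\<^bsub>V\<^esub>"
  using cs_comb[of 0 "\<lambda>_. 0" m] by simp

lemma lower_comb: "act lower_loc (comb c (Suc m)) = comb (\<lambda>i. c (Suc i) * lowering_coeff i) m"
proof -
  have "act lower_loc (comb c (Suc m)) = (\<Oplus>\<^bsub>V\<^esub>i\<in>{..Suc m}. c i \<cdot> act lower_loc (u i))"
    by (rule smult_comb) (simp add: site_algebraD)
  also have "\<dots> = (\<Oplus>\<^bsub>V\<^esub>i\<in>{..m}. c (Suc i) \<cdot> act lower_loc (u (Suc i))) \<oplus>\<^bsub>V\<^esub> c 0 \<cdot> act lower_loc (u 0)"
    by (rule M.finsum_Suc2) auto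
  also have "c 0 \<cdot> act lower_loc (u 0) = \<zero>\<^bsub>V\<^esub>"
    by (simp add: lower_x)
  finally show ?thesis
    unfolding lower_u comb_def by simp
qed

text \<open>Applying \<open>L\<close> exactly \<open>m\<close> times leaves a nonzero multiple of \<open>x\<close>.\<close>

lemma comb_top:
  assumes "submodule H T V" "comb c m \<in> H" "m \<le> len" "c m \<noteq> 0"
  shows "x \<in> H"
  using assms(2-)
proof (induction m arbitrary: c)
  case 0
  have "comb c 0 = c 0 \<cdot> x" using x by (simp add: comb_def)
  then have "(1 / c 0) \<cdot> (c 0 \<cdot> x) \<in> H" using 0 submoduleD[OF assms(1)] by metis
  then show ?case using 0 x by simp
next
  case (Suc m)
  have "act lower_loc (comb c (Suc m)) \<in> H"
    using Suc.prems by (intro submoduleD(6)[OF assms(1)]) (auto simp: site_algebraD)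
  then show ?case
    using Suc.prems lowering_coeff_nonzero[of m] by (intro Suc.IH[of "\<lambda>i. c (Suc i) * lowering_coeff i"]) (auto simp: lower_comb)
qed

text \<open>Zero coefficients at the upper end are dropped until \<open>comb_top\<close> applies.
  With the zero submodule this yields linear independence of the chain, with a general one
  irreducibility.\<close>

lemma comb_nonzero:
  assumes "submodule H T V" "comb c m \<in> H" "m \<le> len" "j \<le> m" "c j \<noteq> 0"
  shows "x \<in> H"
  using assms(2-)
proof (induction m)
  case 0
  then show ?case using comb_top[OF assms(1), of c 0] by simp
next
  case (Suc m)
  show ?case
  proof (cases "c (Suc m) = 0")
    case True
    then have "comb c (Suc m) = comb c m"
      unfolding comb_Suc by (simp del: u.simps)
    moreover have "j \<noteq> Suc m" using True Suc.prems by auto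
    ultimately show ?thesis using Suc by simp
  next
    case False
    then show ?thesis using comb_top[OF assms(1)] Suc.prems by blast
  qed
qed

lemma comb_eq_iff: "comb c len = comb d len \<longleftrightarrow> (\<forall>i\<le>len. c i = d i)"
proof
  assume eq: "comb c len = comb d len"
  have "comb (\<lambda>i. c i + (-1) * d i) len = comb d len \<oplus>\<^bsub>V\<^esub> (-1) \<cdot> comb d len"
    unfolding comb_add[symmetric] cs_comb eq ..
  also have "\<dots> = \<zero>\<^bsub>V\<^esub>"
    using cs_add_left[of "comb d len" 1 "-1"] by simp
  finally have "comb (\<lambda>i. c i + (-1) * d i) len \<in> {\<zero>\<^bsub>V\<^esub>}" by simp
  from comb_nonzero[OF submodule_zero this order_refl] x(2)
  show "\<forall>i\<le>len. c i = d i" by auto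
next
  assume "\<forall>i\<le>len. c i = d i"
  then show "comb c len = comb d len"
    unfolding comb_def by (intro M.finsum_cong') auto
qed

lemma comb_delta: "k \<le> len \<Longrightarrow> comb (\<lambda>i. if i = k then c else 0) len = c \<cdot> u k"
  unfolding comb_def by (subst finsum_delta) auto

text \<open>The right-hand side is the eigenvalue on \<open>u j\<close> of the part \<open>F\<close>
  of \<open>A\<close>, since there \<open>N\<close> is \<open>p\<close> and \<open>Z\<close> is
  \<open>z - j\<close>.\<close>

lemma alpha_eq: "L_alpha q D p (p - z) j
  = (of_nat q - 1) * of_nat p + (2 - of_nat q) * (of_nat z - of_nat j) - of_nat D"
  using z_le_p by (simp add: L_alpha_def of_nat_diff algebra_simps)

lemma gamma_eq: "L_gamma q p (p - z) (Suc j) = lowering_coeff j"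
  using z_le_p by (simp add: L_gamma_def lowering_coeff_def of_nat_diff algebra_simps)

lemma theta_eq: "L_theta q D p (p - z) j = of_nat q * (of_nat z - of_nat j) - of_nat D"
  using z_le_p by (simp add: L_theta_def of_nat_diff algebra_simps)

lemma dual_u: "dual_adj_mat q D \<odot>\<^bsub>V\<^esub> u j = L_theta q D p (p - z) j \<cdot> u j"
  unfolding dual_act[OF u_closed] zero_u theta_eq cs_cs[OF u_closed] cs_add_left[OF u_closed, symmetric]
  by (simp add: algebra_simps)

lemma adj_u:
  assumes "j \<le> len"
  shows "adj_mat q D \<odot>\<^bsub>V\<^esub> u j = comb (\<lambda>i. L_tridiag q D p (p - z) i j) len"
proof -
  let ?a = "L_alpha q D p (p - z) j"
  have low: "act lower_loc (u j) = comb (\<lambda>i. if Suc i = j then L_gamma q p (p - z) j else 0) len"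
  proof (cases j)
    case 0
    then show ?thesis using comb_delta[of 0 0] by (simp add: lower_x)
  next
    case (Suc i)
    have "comb (\<lambda>i'. if Suc i' = j then L_gamma q p (p - z) j else 0) len
        = comb (\<lambda>i'. if i' = i then lowering_coeff i else 0) len"
      unfolding comb_eq_iff Suc gamma_eq by auto
    then show ?thesis using assms by (simp add: comb_delta Suc lower_u del: u.simps)
  qed
  \<comment> \<open>At \<open>j = len\<close> both sides vanish: the chain ends, and the index
    \<open>Suc j\<close> lies outside the range of the combination.\<close>
  have up: "act raise_loc (u j) = comb (\<lambda>i. if i = Suc j then L_beta j else 0) len"
  proof (cases "j = len")
    case True
    have "comb (\<lambda>i. if i = Suc j then L_beta j else 0) len = \<zero>\<^bsub>V\<^esub>"
      unfolding comb_zero[of len, symmetric] comb_eq_iff True by auto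
    then show ?thesis unfolding raise_u True len(2) by (simp del: of_nat_Suc)
  next
    case False
    then have "comb (\<lambda>i. if i = Suc j then L_beta j else 0) len = L_beta j \<cdot> u (Suc j)"
      using assms by (intro comb_delta) simp
    then show ?thesis unfolding raise_u by (simp add: L_beta_def add.commute)
  qed
  have "(of_nat q - 1) \<cdot> act (proj_loc q) (u j) \<oplus>\<^bsub>V\<^esub> ((2 - of_nat q) \<cdot> act zero_loc (u j) \<oplus>\<^bsub>V\<^esub> (- of_nat D) \<cdot> u j)
      = ?a \<cdot> u j"
    unfolding zero_u proj_u alpha_eq cs_cs[OF u_closed] cs_add_left[OF u_closed, symmetric]
    by (simp add: algebra_simps)
  also have "\<dots> = comb (\<lambda>i. if i = j then ?a else 0) len"
    using assms by (simp add: comb_delta)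
  finally have "adj_mat q D \<odot>\<^bsub>V\<^esub> u j = comb (\<lambda>i. ((if Suc i = j then L_gamma q p (p - z) j else 0)
      + (if i = Suc j then L_beta j else 0)) + (if i = j then ?a else 0)) len"
    unfolding adj_act_eq[OF u_closed] low up by (simp only: comb_add)
  also have "\<dots> = comb (\<lambda>i. L_tridiag q D p (p - z) i j) len"
    unfolding comb_eq_iff by (auto simp: L_tridiag_def)
  finally show ?thesis .
qed

lemma span_submodule: "submodule (range (\<lambda>c. comb c len)) T V"
proof (rule submoduleI)
  let ?S = "range (\<lambda>c. comb c len)"
  have S: "\<zero>\<^bsub>V\<^esub> \<in> ?S" "?S \<subseteq> carrier V" "\<And>x y. x \<in> ?S \<Longrightarrow> y \<in> ?S \<Longrightarrow> x \<oplus>\<^bsub>V\<^esub> y \<in> ?S"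
    "\<And>d x. x \<in> ?S \<Longrightarrow> d \<cdot> x \<in> ?S"
  proof -
    show "\<zero>\<^bsub>V\<^esub> \<in> ?S" unfolding comb_zero[of len, symmetric] by (rule rangeI)
  qed (auto simp: comb_add cs_comb)
  then show "?S \<subseteq> carrier V" "\<zero>\<^bsub>V\<^esub> \<in> ?S" "\<And>x y. x \<in> ?S \<Longrightarrow> y \<in> ?S \<Longrightarrow> x \<oplus>\<^bsub>V\<^esub> y \<in> ?S"
    "\<And>d x. x \<in> ?S \<Longrightarrow> d \<cdot> x \<in> ?S" by auto
  have *: "a \<odot>\<^bsub>V\<^esub> y \<in> ?S" if a: "a \<in> carrier T" "\<And>j. j \<le> len \<Longrightarrow> a \<odot>\<^bsub>V\<^esub> u j \<in> ?S" and y: "y \<in> ?S" for a y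
  proof -
    obtain c where c: "y = comb c len" using y by auto
    show ?thesis
      unfolding c smult_comb[OF a(1)]
      by (rule finsum_mem) (use a(2) S in \<open>simp_all add: Pi_iff\<close>)
  qed
  show "adj_mat q D \<odot>\<^bsub>V\<^esub> y \<in> ?S" if "y \<in> ?S" for y
    by (rule *[OF _ _ that]) (simp_all add: adj_u)
  have u_S: "u j \<in> ?S" if "j \<le> len" for j
    using comb_delta[OF that, of 1] by (metis cs_one rangeI u_closed)
  show "dual_adj_mat q D \<odot>\<^bsub>V\<^esub> y \<in> ?S" if "y \<in> ?S" for y
    by (rule *[OF _ _ that]) (simp_all only: generators_in_terwilliger dual_u S(4) u_S)
qed

text \<open>Every nonzero submodule contains \<open>x\<close> by \<open>comb_nonzero\<close>, so a
  module generated by \<open>x\<close> is irreducible. Stated for generators, the result applies to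
  submodules of the standard module as well as to irreducible modules.\<close>

lemma cyclic_is_L_module:
  assumes cyclic: "\<And>H. submodule H T V \<Longrightarrow> x \<in> H \<Longrightarrow> H = carrier V"
  shows "is_L_module q D p (p - z) V" and "p - z \<le> p div 2"
proof -
  have dim: "p - 2 * (p - z) + 1 = Suc len" and "p - z \<le> p div 2"
    using len(1) z_le_p by auto
  then show "p - z \<le> p div 2" by simp
  have x_span: "x \<in> range (\<lambda>c. comb c len)"
    using comb_delta[of 0 1] x by (metis cs_one rangeI u.simps(1) zero_le)
  have span: "range (\<lambda>c. comb c len) = carrier V"
    by (rule cyclic[OF span_submodule x_span])
  have "irreducible_module T V"
    unfolding irreducible_module_def
  proof (intro conjI allI impI)
    show "left_module T V" by unfold_locales
    show "carrier V \<noteq> {\<zero>\<^bsub>V\<^esub>}" using x by blast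
    fix H assume H: "submodule H T V"
    show "H = {\<zero>\<^bsub>V\<^esub>} \<or> H = carrier V"
    proof (cases "H = {\<zero>\<^bsub>V\<^esub>}")
      case False
      then obtain h where h: "h \<in> H" "h \<noteq> \<zero>\<^bsub>V\<^esub>" using submoduleD(2)[OF H] by blast
      then have "h \<in> range (\<lambda>c. comb c len)" using submoduleD(1)[OF H] span by auto
      then obtain c where c: "h = comb c len" by auto
      have "\<exists>j\<le>len. c j \<noteq> 0"
      proof (rule ccontr)
        assume "\<not> (\<exists>j\<le>len. c j \<noteq> 0)"
        then have "h = \<zero>\<^bsub>V\<^esub>" unfolding c comb_zero[of len, symmetric] comb_eq_iff by auto
        then show False using h by simp
      qed
      then have "x \<in> H" using comb_nonzero[OF H] h c by blast
      then show ?thesis using cyclic[OF H] by simp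
    qed simp
  qed
  moreover have "is_basis (hvertices q D) V (Suc len) u"
    unfolding is_basis_def lessThan_Suc_atMost comb_def[symmetric]
  proof (intro conjI ballI)
    fix y assume "y \<in> carrier V"
    then obtain c where c: "y = comb c len" using span by (metis imageE)
    show "\<exists>!c. c \<in> {..len} \<rightarrow>\<^sub>E UNIV \<and> y = comb c len"
    \<comment> \<open>\<open>is_basis\<close> counts extensional coefficient families, so the
      coefficients are restricted to the index range.\<close>
    proof (rule ex1I[of _ "restrict c {..len}"])
      have "comb c len = comb (restrict c {..len}) len" unfolding comb_eq_iff by simp
      then show "restrict c {..len} \<in> {..len} \<rightarrow>\<^sub>E UNIV \<and> y = comb (restrict c {..len}) len"
        using c by auto
    next
      fix d assume "d \<in> {..len} \<rightarrow>\<^sub>E UNIV \<and> y = comb d len"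
      then show "d = restrict c {..len}"
        unfolding c comb_eq_iff by (auto simp: PiE_def extensional_def)
    qed
  qed auto
  moreover have "acts_by (hvertices q D) V (Suc len) u (adj_mat q D) (L_tridiag q D p (p - z))"
    unfolding acts_by_def lessThan_Suc_atMost comb_def[symmetric] by (simp add: adj_u)
  moreover have "acts_by (hvertices q D) V (Suc len) u (dual_adj_mat q D) (L_diag q D p (p - z))"
    unfolding acts_by_def lessThan_Suc_atMost comb_def[symmetric] L_diag_def
    by (simp add: dual_u comb_delta cong: if_cong)
  ultimately show "is_L_module q D p (p - z) V"
    unfolding is_L_module_def dim by blast
qed

end

section \<open>Classification of the irreducible modules\<close>

lemma irreducible_is_L_module:
  assumes irr: "irreducible_module (terwilliger_algebra q D) V" and "q \<ge> 3"
  obtains p k where "(p, k) \<in> index_pairs D" "is_L_module q D p k V"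
proof -
  interpret hamming_module q D V
    using irr assms(2) unfolding irreducible_module_def hamming_module_def hamming_module_axioms_def by auto
  obtain y where y: "y \<in> carrier V" "y \<noteq> \<zero>\<^bsub>V\<^esub>"
    using irr M.zero_closed unfolding irreducible_module_def by blast
  obtain p y' where p: "p \<le> D" "y' \<in> carrier V" "y' \<noteq> \<zero>\<^bsub>V\<^esub>" "act (proj_loc q) y' = of_nat p \<cdot> y'"
    using proj_eigenvector[OF y] by metis
  have "{v \<in> carrier V. act (proj_loc q) v = of_nat p \<cdot> v} = carrier V"
    using irr proj_eigenspace_submodule[of "of_nat p"] p unfolding irreducible_module_def by blast
  then have proj: "act (proj_loc q) v = of_nat p \<cdot> v" if "v \<in> carrier V" for v
    using that by blast
  \<comment> \<open>The eigenvalues of \<open>Z\<close>, a nonempty subset of the numbers up to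
    \<open>D\<close>. For an eigenvector \<open>x\<close> at the maximum, a nonzero
    \<open>L x\<close> would have the eigenvalue \<open>Max J + 1\<close>, again in
    \<open>J\<close>.\<close>
  define J where "J = {j. j \<le> D \<and> (\<exists>v\<in>carrier V. v \<noteq> \<zero>\<^bsub>V\<^esub> \<and> act zero_loc v = of_nat j \<cdot> v)}"
  have "finite J" by (auto simp: J_def)
  moreover have "J \<noteq> {}" 
  proof -
    obtain j w where "j \<le> D" "w \<in> carrier V" "w \<noteq> \<zero>\<^bsub>V\<^esub>" "act zero_loc w = of_nat j \<cdot> w"
      by (rule zero_eigenvector[OF y])
    then show ?thesis unfolding J_def by blast
  qed
  ultimately have z: "Max J \<in> J" "\<And>j. j \<in> J \<Longrightarrow> j \<le> Max J" by auto
  then obtain x where x: "x \<in> carrier V" "x \<noteq> \<zero>\<^bsub>V\<^esub>" "act zero_loc x = of_nat (Max J) \<cdot> x"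
    by (auto simp: J_def)
  have low: "act lower_loc x = \<zero>\<^bsub>V\<^esub>"
  proof (rule ccontr)
    assume nz: "act lower_loc x \<noteq> \<zero>\<^bsub>V\<^esub>"
    have e: "act zero_loc (act lower_loc x) = of_nat (Suc (Max J)) \<cdot> act lower_loc x"
      using x cs_add_left[of "act lower_loc x" "of_nat (Max J)" 1]
      by (simp add: zero_lower act_cs add.commute)
    obtain j where "j \<le> D" "(of_nat (Suc (Max J)) :: complex) = of_nat j"
      by (rule zero_eigenvalue[OF act_closed[OF site_algebra(4) x(1)] nz e])
    then have "Suc (Max J) \<le> D" unfolding of_nat_eq_iff by simp
    then have "Suc (Max J) \<in> J"
      using e nz x unfolding J_def by (auto intro!: bexI[of _ "act lower_loc x"])
    then show False using z(2) by fastforce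
  qed
  interpret weight_chain q D V x p "Max J"
    by unfold_locales (use x low proj in auto)
  have cyc: "H = carrier V" if "submodule H T V" "x \<in> H" for H
    using irr that x unfolding irreducible_module_def by blast
  show thesis
    by (rule that[of p "p - Max J"]) (use cyclic_is_L_module[OF cyc] p in \<open>auto simp: index_pairs_def\<close>)
qed

text \<open>The submodule generated by \<open>x\<close>. Only the carrier is changed, so zero and
  the operations remain those of \<open>V\<close>; a submodule containing \<open>x\<close> contains
  every \<open>a x\<close>.\<close>

lemma cyclic_submodule:
  assumes "hamming_module q D V" "x \<in> carrier V"
  defines "W \<equiv> V\<lparr>carrier := (\<lambda>a. a \<odot>\<^bsub>V\<^esub> x) ` carrier (terwilliger_algebra q D)\<rparr>"
  shows "hamming_module q D W"
    and "x \<in> carrier W"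
    and "\<And>H. submodule H (terwilliger_algebra q D) W \<Longrightarrow> x \<in> H \<Longrightarrow> H = carrier W"
proof -
  interpret hamming_module q D V by fact
  have W: "carrier W = (\<lambda>a. a \<odot>\<^bsub>V\<^esub> x) ` carrier T" "\<zero>\<^bsub>W\<^esub> = \<zero>\<^bsub>V\<^esub>"
    "a \<oplus>\<^bsub>W\<^esub> b = a \<oplus>\<^bsub>V\<^esub> b" "t \<odot>\<^bsub>W\<^esub> b = t \<odot>\<^bsub>V\<^esub> b" for a b t
    by (simp_all add: W_def)
  have sub: "v \<in> carrier V" if "v \<in> carrier W" for v
    using that assms(2) by (auto simp: W smult_closed)
  have add: "v \<oplus>\<^bsub>V\<^esub> w \<in> carrier W" if vw: "v \<in> carrier W" "w \<in> carrier W" for v w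
  proof -
    obtain a b where "a \<in> carrier T" "b \<in> carrier T" "v = a \<odot>\<^bsub>V\<^esub> x" "w = b \<odot>\<^bsub>V\<^esub> x"
      using vw by (auto simp: W)
    then show ?thesis using assms(2) by (auto simp: W smult_l_distr[symmetric])
  qed
  have mult: "t \<odot>\<^bsub>V\<^esub> v \<in> carrier W" if tv: "t \<in> carrier T" "v \<in> carrier W" for t v
  proof -
    obtain a where "a \<in> carrier T" "v = a \<odot>\<^bsub>V\<^esub> x" using tv by (auto simp: W)
    then show ?thesis using tv assms(2) by (auto simp: W smult_assoc[symmetric])
  qed
  have zero: "\<zero>\<^bsub>V\<^esub> \<in> carrier W"
    unfolding W using assms(2) by (intro image_eqI[of _ _ "\<zero>\<^bsub>T\<^esub>"]) auto
  show "x \<in> carrier W"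
    unfolding W using smult_one[OF assms(2)] by (intro image_eqI[of _ _ "\<one>\<^bsub>T\<^esub>"]) auto
  have "abelian_group W"
  proof (rule abelian_groupI)
    fix v assume v: "v \<in> carrier W"
    have "(-1) \<cdot> v \<oplus>\<^bsub>V\<^esub> v = \<zero>\<^bsub>V\<^esub>"
      using cs_add_left[OF sub[OF v], of "-1" 1] sub[OF v] by simp
    moreover have "(-1) \<cdot> v \<in> carrier W" using mult[OF _ v] by (simp add: cscale_def)
    ultimately show "\<exists>w\<in>carrier W. w \<oplus>\<^bsub>W\<^esub> v = \<zero>\<^bsub>W\<^esub>" by (auto simp: W(2-))
  qed (use sub add zero in \<open>auto simp: W(2-) M.a_ac\<close>)
  then have "left_module T W"
    using R.ring_axioms
    by (intro left_module.intro left_module_axioms.intro)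
       (use sub mult in \<open>auto simp: W(2-) smult_l_distr smult_r_distr smult_assoc smult_one\<close>)
  then show "hamming_module q D W"
    using q_ge by (simp add: hamming_module_def hamming_module_axioms_def)
  then interpret W: hamming_module q D W .
  fix H assume H: "submodule H T W" "x \<in> H"
  have "carrier W \<subseteq> H"
    using W.submoduleD(6)[OF H(1) _ H(2)] by (auto simp: W(1,4))
  then show "H = carrier W" using W.submoduleD(1)[OF H(1)] by auto
qed

lemma lowest_weight_is_L_module:
  assumes "weight_chain q D V x p z"
  defines "W \<equiv> V\<lparr>carrier := (\<lambda>a. a \<odot>\<^bsub>V\<^esub> x) ` carrier (terwilliger_algebra q D)\<rparr>"
  shows "is_L_module q D p (p - z) W"
proof -
  interpret weight_chain q D V x p z by fact
  note W = cyclic_submodule[OF hamming_module_axioms x(1), folded W_def]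
  have "weight_chain q D W x p z"
    using W(1,2) x lower_x zero_x proj_x
    by (intro weight_chain.intro weight_chain_axioms.intro) (simp_all add: W_def cscale_def)
  from weight_chain.cyclic_is_L_module(1)[OF this W(3)] show ?thesis .
qed

section \<open>Lowest weight vectors in the standard module\<close>

text \<open>The fields \<open>mult\<close> and \<open>one\<close> of a module record are irrelevant and filled arbitrarily, here and below.\<close>

definition standard_module :: "nat \<Rightarrow> nat \<Rightarrow> ((nat \<Rightarrow> nat) \<Rightarrow> complex) tmodule" where
  "standard_module q D =
    \<lparr>carrier = {f. \<forall>x. x \<notin> hvertices q D \<longrightarrow> f x = 0},
     monoid.mult = (\<lambda>f g. f), one = (\<lambda>_. 0), zero = (\<lambda>_. 0),
     add = (\<lambda>f g x. f x + g x),
     smult = (\<lambda>M f x. \<Sum>y\<in>hvertices q D. M x y * f y)\<rparr>"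

lemma standard_module_simps [simp]:
  "f \<in> carrier (standard_module q D) \<longleftrightarrow> (\<forall>x. x \<notin> hvertices q D \<longrightarrow> f x = 0)"
  "\<zero>\<^bsub>standard_module q D\<^esub> = (\<lambda>_. 0)"
  "f \<oplus>\<^bsub>standard_module q D\<^esub> g = (\<lambda>x. f x + g x)"
  "M \<odot>\<^bsub>standard_module q D\<^esub> f = (\<lambda>x. \<Sum>y\<in>hvertices q D. M x y * f y)"
  by (simp_all add: standard_module_def)

lemma hamming_module_standard:
  assumes "q \<ge> 3"
  shows "hamming_module q D (standard_module q D)"
proof -
  let ?V = "standard_module q D"
  have "abelian_group ?V"
  proof (rule abelian_groupI)
    fix f assume "f \<in> carrier ?V"
    then show "\<exists>g\<in>carrier ?V. g \<oplus>\<^bsub>?V\<^esub> f = \<zero>\<^bsub>?V\<^esub>"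
      by (intro bexI[of _ "\<lambda>x. - f x"]) auto
  qed (auto simp: algebra_simps)
  moreover have "left_module_axioms (terwilliger_algebra q D) ?V"
  proof (rule left_module_axioms.intro)
    fix M f assume "M \<in> carrier (terwilliger_algebra q D)" "f \<in> carrier ?V"
    then show "M \<odot>\<^bsub>?V\<^esub> f \<in> carrier ?V"
      using terwilliger_in_cmat[of M q D] by auto
  next
    fix M N f
    show "(M \<otimes>\<^bsub>terwilliger_algebra q D\<^esub> N) \<odot>\<^bsub>?V\<^esub> f = M \<odot>\<^bsub>?V\<^esub> (N \<odot>\<^bsub>?V\<^esub> f)"
      by (simp add: terwilliger_simps) (intro ext cmat_mult_assoc)
  next
    fix f assume "f \<in> carrier ?V"
    then show "\<one>\<^bsub>terwilliger_algebra q D\<^esub> \<odot>\<^bsub>?V\<^esub> f = f"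
      by (auto simp: terwilliger_simps sum_scalar_cmat_left intro!: ext)
  qed (auto simp: terwilliger_simps algebra_simps sum.distrib)
  ultimately show ?thesis
    using ring_terwilliger assms
    by (simp add: hamming_module_def hamming_module_axioms_def left_module_def)
qed

section \<open>Copies of a module inside another type\<close>

text \<open>Isomorphism classes refer to one element type \<open>'v\<close>, while the standard
  module consists of functions. An injection on the carrier produces an isomorphic copy in the
  required type.\<close>

definition transport_module :: "('v \<Rightarrow> 'w) \<Rightarrow> ('a, 'v) module \<Rightarrow> ('a, 'w) module" where
  "transport_module g V =
    \<lparr>carrier = g ` carrier V,
     monoid.mult = (\<lambda>x y. x), one = g \<zero>\<^bsub>V\<^esub>, zero = g \<zero>\<^bsub>V\<^esub>,
     add = (\<lambda>x y. g (inv_into (carrier V) g x \<oplus>\<^bsub>V\<^esub> inv_into (carrier V) g y)),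
     smult = (\<lambda>a x. g (a \<odot>\<^bsub>V\<^esub> inv_into (carrier V) g x))\<rparr>"

lemma transport_module_simps:
  "carrier (transport_module g V) = g ` carrier V"
  "\<zero>\<^bsub>transport_module g V\<^esub> = g \<zero>\<^bsub>V\<^esub>"
  "inj_on g (carrier V) \<Longrightarrow> x \<in> carrier V \<Longrightarrow> y \<in> carrier V
    \<Longrightarrow> g x \<oplus>\<^bsub>transport_module g V\<^esub> g y = g (x \<oplus>\<^bsub>V\<^esub> y)"
  "inj_on g (carrier V) \<Longrightarrow> x \<in> carrier V \<Longrightarrow> a \<odot>\<^bsub>transport_module g V\<^esub> g x = g (a \<odot>\<^bsub>V\<^esub> x)"
  by (simp_all add: transport_module_def)

lemma left_module_transport:
  assumes "left_module R V" "inj_on g (carrier V)"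
  shows "left_module R (transport_module g V)"
proof -
  interpret left_module R V by fact
  note simps = transport_module_simps(1,2) transport_module_simps(3,4)[OF assms(2)]
  have "abelian_group (transport_module g V)"
  proof (rule abelian_groupI)
    fix x assume "x \<in> carrier (transport_module g V)"
    then obtain y where "y \<in> carrier V" "x = g y" by (auto simp: simps)
    then show "\<exists>y\<in>carrier (transport_module g V). y \<oplus>\<^bsub>transport_module g V\<^esub> x = \<zero>\<^bsub>transport_module g V\<^esub>"
      by (intro bexI[of _ "g (\<ominus>\<^bsub>V\<^esub> y)"]) (auto simp: simps M.l_neg)
  qed (auto simp: simps M.a_ac)
  then show ?thesis
    using R.ring_axioms
    by (intro left_module.intro left_module_axioms.intro)
       (auto simp: simps smult_closed smult_l_distr smult_r_distr smult_assoc smult_one)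
qed

lemma weight_chain_transport:
  assumes "weight_chain q D V x p z" "inj_on g (carrier V)"
  shows "weight_chain q D (transport_module g V) (g x) p z"
proof -
  interpret weight_chain q D V x p z by fact
  have "left_module T (transport_module g V)"
    by (rule left_module_transport[OF left_module_axioms assms(2)])
  moreover have "g x \<noteq> g \<zero>\<^bsub>V\<^esub>"
    using assms(2) x by (auto dest: inj_onD)
  ultimately show ?thesis
    using q_ge x lower_x zero_x proj_x assms(2)
    by (simp add: weight_chain_def weight_chain_axioms_def hamming_module_def hamming_module_axioms_def
        transport_module_simps cscale_def)
qed

lemma inj_complex_pair: "\<exists>f :: complex \<times> complex \<Rightarrow> complex. inj f"
proof -
  have "\<not> finite (UNIV :: complex set)" by (rule infinite_UNIV_char_0)
  from card_of_ordIso[THEN iffD2, OF card_of_Times_same_infinite[OF this]]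
  obtain f where "bij_betw f ((UNIV :: complex set) \<times> (UNIV :: complex set)) (UNIV :: complex set)" by blast
  then show ?thesis by (auto simp: bij_betw_def)
qed

text \<open>The values are absorbed one coordinate at a time by an injection of pairs into single
  numbers. Hence an embedding of the complex numbers into \<open>'v\<close> makes room for the
  standard module.\<close>

lemma inj_finite_support:
  assumes "finite (S :: 'i set)"
  shows "\<exists>g :: ('i \<Rightarrow> complex) \<Rightarrow> complex. inj_on g {f. \<forall>x. x \<notin> S \<longrightarrow> f x = 0}"
  using assms
proof (induction S)
  case empty
  have "inj_on (\<lambda>_ :: 'i \<Rightarrow> complex. 0 :: complex) {f. \<forall>x. x \<notin> {} \<longrightarrow> f x = 0}"
    by (auto intro!: inj_onI)
  then show ?case by blast
next
  case (insert a S)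
  obtain g :: "('i \<Rightarrow> complex) \<Rightarrow> complex" where g: "inj_on g {f. \<forall>x. x \<notin> S \<longrightarrow> f x = 0}"
    using insert.IH by blast
  obtain h :: "complex \<times> complex \<Rightarrow> complex" where h: "inj h" using inj_complex_pair by blast
  have "inj_on (\<lambda>f. h (f a, g (f(a := 0)))) {f. \<forall>x. x \<notin> insert a S \<longrightarrow> f x = 0}"
  proof (rule inj_onI)
    fix f f' :: "'i \<Rightarrow> complex"
    assume f: "f \<in> {f. \<forall>x. x \<notin> insert a S \<longrightarrow> f x = 0}" "f' \<in> {f. \<forall>x. x \<notin> insert a S \<longrightarrow> f x = 0}"
      and "h (f a, g (f(a := 0))) = h (f' a, g (f'(a := 0)))"
    then have eq: "f a = f' a" "g (f(a := 0)) = g (f'(a := 0))" using h by (auto dest: injD)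
    have "f(a := 0) = f'(a := 0)"
      using eq(2) f by (intro inj_onD[OF g]) (auto split: if_splits)
    then show "f = f'" using eq(1) by (metis fun_upd_triv fun_upd_upd)
  qed
  then show ?case by blast
qed

section \<open>The explicit lowest weight vectors\<close>

text \<open>The coefficients of the antisymmetric two-site vector: zero when both letters are 0 or
  both are nonzero, otherwise a sign telling which of them is 0.\<close>

definition pair_sign :: "nat \<Rightarrow> nat \<Rightarrow> complex" where
  "pair_sign a b = (if a = 0 then 1 else 0) - (if b = 0 then 1 else 0)"

text \<open>The coefficients of \<open>e\<^sub>1 - e\<^sub>2\<close>, a one-site vector killed by
  the projection; the letter 2 exists because \<open>q \<ge> 3\<close>.\<close>

definition tail_sign :: "nat \<Rightarrow> complex" where
  "tail_sign a = (if a = 1 then 1 else 0) - (if a = 2 then 1 else 0)"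

text \<open>
  The sites \<open>2 j\<close> and \<open>2 j + 1\<close> with \<open>j < k\<close> carry \<open>e\<^sub>0 \<otimes> s - s \<otimes> e\<^sub>0\<close> with \<open>s = e\<^sub>1 + \<dots> + e\<^bsub>q-1\<^esub>\<close>.
\<close>

definition lowest :: "nat \<Rightarrow> nat \<Rightarrow> nat \<Rightarrow> (nat \<Rightarrow> nat) \<Rightarrow> complex" where
  "lowest D p k x = (\<Prod>j<k. pair_sign (x (2 * j)) (x (2 * j + 1))) *
     (\<Prod>i\<in>{2 * k..<p}. if x i = 0 then 1 else 0) * (\<Prod>i\<in>{p..<D}. tail_sign (x i))"

lemma sum_pairs: "(\<Sum>i<2 * (k :: nat). f i) = (\<Sum>j<k. f (2 * j) + (f (2 * j + 1) :: 'a :: comm_monoid_add))"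
  by (induction k) (simp_all add: add.assoc)

lemma sum_three:
  fixes k p D :: nat
  assumes "2 * k \<le> p" "p \<le> D"
  shows "(\<Sum>i<D. f i) = (\<Sum>j<k. f (2 * j) + f (2 * j + 1)) + (\<Sum>i\<in>{2 * k..<p}. f i)
    + (\<Sum>i\<in>{p..<D}. (f i :: 'a :: comm_monoid_add))"
proof -
  have "(\<Sum>i<D. f i) = (\<Sum>i<2 * k. f i) + (\<Sum>i\<in>{2 * k..<p}. f i) + (\<Sum>i\<in>{p..<D}. f i)"
    using assms by (simp add: lessThan_atLeast0 sum.atLeastLessThan_concat)
  then show ?thesis unfolding sum_pairs .
qed

context
  fixes q D p k :: nat
  assumes q: "3 \<le> q" and k: "2 * k \<le> p" and p: "p \<le> D"
begin

text \<open>At the sites below \<open>p\<close> all nonzero letters have the same coefficient, so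
  these factors lie in the image of the projection.\<close>

lemma lowest_cong:
  assumes "\<And>i. i < p \<Longrightarrow> x i = 0 \<longleftrightarrow> y i = 0" "\<And>i. p \<le> i \<Longrightarrow> x i = y i"
  shows "lowest D p k x = lowest D p k y"
proof -
  have "pair_sign (x (2 * j)) (x (2 * j + 1)) = pair_sign (y (2 * j)) (y (2 * j + 1))" if "j < k" for j
    using assms(1)[of "2 * j"] assms(1)[of "2 * j + 1"] that k by (simp add: pair_sign_def)
  then show ?thesis using assms by (simp add: lowest_def)
qed

text \<open>The letter 1 is the reference because \<open>tail_sign 1\<close> is 1: the value there
  is the product of the remaining factors.\<close>

lemma lowest_tail:
  assumes "p \<le> i" "i < D"
  shows "lowest D p k (x(i := a)) = tail_sign a * lowest D p k (x(i := 1))"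
proof -
  have tail: "(\<Prod>l\<in>{p..<D}. tail_sign ((x(i := b)) l)) = tail_sign b * (\<Prod>l\<in>{p..<D} - {i}. tail_sign (x l))" for b
    using assms by (subst prod.remove[of _ i]) auto
  have mid: "(\<Prod>l\<in>{2 * k..<p}. if (x(i := b)) l = 0 then 1 else 0) = (\<Prod>l\<in>{2 * k..<p}. if x l = 0 then 1 else (0::complex))" for b
    using assms by (intro prod.cong) auto
  have pairs: "(\<Prod>j<k. pair_sign ((x(i := b)) (2 * j)) ((x(i := b)) (2 * j + 1))) = (\<Prod>j<k. pair_sign (x (2 * j)) (x (2 * j + 1)))" for b
    using assms k by (intro prod.cong) auto
  have "tail_sign 1 = 1" by (simp add: tail_sign_def)
  then show ?thesis unfolding lowest_def tail mid pairs by simp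
qed

lemma lowest_pair:
  assumes "j < k"
  shows "lowest D p k (x(2 * j := a, 2 * j + 1 := b))
    = pair_sign a b * lowest D p k (x(2 * j := 0, 2 * j + 1 := 1))"
proof -
  have jp: "2 * j + 1 < 2 * k" using assms by simp
  have tail: "(\<Prod>l\<in>{p..<D}. tail_sign ((x(2 * j := a, 2 * j + 1 := b)) l)) = (\<Prod>l\<in>{p..<D}. tail_sign (x l))" for a b
    using jp k by (intro prod.cong) auto
  have mid: "(\<Prod>l\<in>{2 * k..<p}. if (x(2 * j := a, 2 * j + 1 := b)) l = 0 then 1 else 0)
      = (\<Prod>l\<in>{2 * k..<p}. if x l = 0 then 1 else (0::complex))" for a b
    using jp by (intro prod.cong) auto
  \<comment> \<open>Parity keeps the two updated sites apart from the sites of all other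
    pairs.\<close>
  have par: "2 * i \<noteq> 2 * l + 1" "2 * l + 1 \<noteq> 2 * i" for i l :: nat by presburger+
  have pairs: "(\<Prod>i<k. pair_sign ((x(2 * j := a, 2 * j + 1 := b)) (2 * i)) ((x(2 * j := a, 2 * j + 1 := b)) (2 * i + 1)))
      = pair_sign a b * (\<Prod>i\<in>{..<k} - {j}. pair_sign (x (2 * i)) (x (2 * i + 1)))" for a b
    using assms par by (subst prod.remove[of _ j]) (auto intro!: prod.cong)
  have "pair_sign 0 1 = 1" by (simp add: pair_sign_def)
  then show ?thesis unfolding lowest_def tail mid pairs by simp
qed

lemma sum_tail_sign: "(\<Sum>a\<in>{1..<q}. tail_sign a) = 0"
proof -
  have "{1..<q} = insert 1 (insert 2 {3..<q})" using q by auto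
  then show ?thesis by (simp add: tail_sign_def)
qed

lemma local_proj:
  "local_op q (proj_loc q) i f x
    = (if x i = 0 then f x else (\<Sum>a\<in>{1..<q}. f (x(i := a))) / (of_nat q - 1))"
  using q by (auto simp: local_op_def sum_split0 proj_loc_def fun_upd_idem sum_divide_distrib)

lemma local_lower:
  "local_op q lower_loc i f x = (if x i = 0 then \<Sum>a\<in>{1..<q}. f (x(i := a)) else 0)"
  using q by (auto simp: local_op_def sum_split0 lower_loc_def)

lemma q1: "of_nat q - 1 \<noteq> (0::complex)"
  using q by (intro of_nat_diff_one_nonzero) simp

text \<open>The coefficients 1 and -1 of \<open>e\<^sub>1 - e\<^sub>2\<close> cancel. This kills
  \<open>L\<close> and the averaging part of the projection at the tail sites.\<close>

lemma sum_lowest_tail: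
  assumes "p \<le> i" "i < D"
  shows "(\<Sum>a\<in>{1..<q}. lowest D p k (x(i := a))) = 0"
proof -
  have "(\<Sum>a\<in>{1..<q}. lowest D p k (x(i := a))) = (\<Sum>a\<in>{1..<q}. tail_sign a * lowest D p k (x(i := 1)))"
    by (intro sum.cong refl lowest_tail assms)
  also have "\<dots> = (\<Sum>a\<in>{1..<q}. tail_sign a) * lowest D p k (x(i := 1))"
    by (rule sum_distrib_right[symmetric])
  finally show ?thesis unfolding sum_tail_sign by simp
qed

text \<open>The one-site projection fixes the factors at the \<open>p\<close> sites below
  \<open>p\<close> and annihilates the tail factors.\<close>

lemma proj_lowest: "site_op q D (proj_loc q) (lowest D p k) x = of_nat p * lowest D p k x"
proof -
  have "local_op q (proj_loc q) i (lowest D p k) x = lowest D p k x" if "i < p" for i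
  proof (cases "x i = 0")
    case False
    have "lowest D p k (x(i := a)) = lowest D p k x" if "a \<in> {1..<q}" for a
      using that False \<open>i < p\<close> by (intro lowest_cong) auto
    then have "(\<Sum>a\<in>{1..<q}. lowest D p k (x(i := a))) = (of_nat q - 1) * lowest D p k x"
      using q by simp
    then show ?thesis using q1 False by (simp add: local_proj)
  qed (simp add: local_proj)
  moreover have "local_op q (proj_loc q) i (lowest D p k) x = 0" if "i \<in> {p..<D}" for i
    using that lowest_tail[of i x 0] sum_lowest_tail[of i x]
    by (auto simp: local_proj fun_upd_idem tail_sign_def)
  moreover have "(\<Sum>i<D. local_op q (proj_loc q) i (lowest D p k) x)
      = (\<Sum>i<p. local_op q (proj_loc q) i (lowest D p k) x) + (\<Sum>i\<in>{p..<D}. local_op q (proj_loc q) i (lowest D p k) x)"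
    using p by (simp add: lessThan_atLeast0 sum.atLeastLessThan_concat)
  ultimately show ?thesis by (simp add: site_op_def)
qed

text \<open>On a pair, lowering the second site of \<open>e\<^sub>0 \<otimes> s\<close> and the
  first site of \<open>- s \<otimes> e\<^sub>0\<close> gives opposite multiples of
  \<open>e\<^sub>0 \<otimes> e\<^sub>0\<close>. The single factors \<open>e\<^sub>0\<close> and the
  tail factors are killed one by one.\<close>

lemma lower_lowest: "site_op q D lower_loc (lowest D p k) x = 0"
proof -
  let ?f = "\<lambda>i. local_op q lower_loc i (lowest D p k) x"
  have "?f (2 * j) + ?f (2 * j + 1) = 0" if "j < k" for j
  proof -
    let ?c = "lowest D p k (x(2 * j := 0, 2 * j + 1 := 1))"
    have jp: "2 * j < p" "2 * j + 1 < p" using that k by auto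
    have "x(2 * j := a) = x(2 * j := a, 2 * j + 1 := x (2 * j + 1))" for a by auto
    then have "lowest D p k (x(2 * j := a)) = pair_sign a (x (2 * j + 1)) * ?c" for a
      using lowest_pair[OF that] by metis
    moreover have "x(2 * j + 1 := a) = x(2 * j := x (2 * j), 2 * j + 1 := a)" for a by auto
    then have "lowest D p k (x(2 * j + 1 := a)) = pair_sign (x (2 * j)) a * ?c" for a
      using lowest_pair[OF that] by metis
    ultimately have "?f (2 * j) = (if x (2 * j) = 0 then (\<Sum>a\<in>{1..<q}. - (if x (2 * j + 1) = 0 then 1 else 0) * ?c) else 0)"
      "?f (2 * j + 1) = (if x (2 * j + 1) = 0 then (\<Sum>a\<in>{1..<q}. (if x (2 * j) = 0 then 1 else 0) * ?c) else 0)"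
      unfolding local_lower by (auto simp: pair_sign_def intro!: sum.cong)
    then show ?thesis using q by simp
  qed
  moreover have "?f i = 0" if "i \<in> {2 * k..<p}" for i
  proof -
    have "lowest D p k (x(i := a)) = 0" if "a \<in> {1..<q}" for a
    proof -
      have "(\<Prod>l\<in>{2 * k..<p}. if (x(i := a)) l = 0 then 1 else (0::complex)) = 0"
        using \<open>i \<in> _\<close> that by (intro prod_zero) auto
      then show ?thesis by (simp only: lowest_def) simp
    qed
    then show ?thesis by (simp add: local_lower)
  qed
  moreover have "?f i = 0" if "i \<in> {p..<D}" for i
    using that sum_lowest_tail by (simp add: local_lower)
  ultimately show ?thesis
    unfolding site_op_def sum_three[OF k p] by simp
qed

text \<open>On the support each pair has exactly one zero, the middle sites are all zero and the
  tail has none: \<open>k + (p - 2 k)\<close> zeros in total.\<close>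

lemma zeros_lowest: "of_nat (hzeros D x) * lowest D p k x = of_nat (p - k) * lowest D p k x"
proof (cases "lowest D p k x = 0")
  case False
  let ?z = "\<lambda>i. if x i = 0 then 1 else (0::complex)"
  have nz: "\<And>j. j < k \<Longrightarrow> pair_sign (x (2 * j)) (x (2 * j + 1)) \<noteq> 0"
    "\<And>i. i \<in> {2 * k..<p} \<Longrightarrow> x i = 0"
    "\<And>i. i \<in> {p..<D} \<Longrightarrow> tail_sign (x i) \<noteq> 0"
    using False by (auto simp: lowest_def split: if_splits)
  have "?z (2 * j) + ?z (2 * j + 1) = 1" if "j < k" for j
    using nz(1)[OF that] by (auto simp: pair_sign_def split: if_splits)
  moreover have "?z i = 1" if "i \<in> {2 * k..<p}" for i using nz(2)[OF that] by simp
  moreover have "?z i = 0" if "i \<in> {p..<D}" for i using nz(3)[OF that] by (auto simp: tail_sign_def split: if_splits)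
  ultimately have "(of_nat (hzeros D x) :: complex) = of_nat k + of_nat (p - 2 * k)"
    unfolding hzeros_eq_sum sum_three[OF k p] by simp
  also have "\<dots> = of_nat (p - k)"
    unfolding of_nat_add[symmetric] using k by simp
  finally show ?thesis by simp
qed simp

lemma lowest_nonzero: "\<exists>x\<in>hvertices q D. lowest D p k x \<noteq> 0"
proof -
  \<comment> \<open>The pairs are (0, 1), the middle letters 0 and the tail letters 1, so that every
    factor of \<open>lowest\<close> equals 1.\<close>
  define x where "x = (\<lambda>i\<in>{..<D}. if i < 2 * k then i mod 2 else if i < p then 0 else 1 :: nat)"
  have "x \<in> hvertices q D" using q by (auto simp: x_def hvertices_def)
  moreover have "lowest D p k x = 1"
  proof -
    have "pair_sign (x (2 * j)) (x (2 * j + 1)) = 1" if "j < k" for j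
      using that k p by (simp add: x_def pair_sign_def)
    moreover have "x i = 0" if "i \<in> {2 * k..<p}" for i using that p by (simp add: x_def)
    moreover have "tail_sign (x i) = 1" if "i \<in> {p..<D}" for i
      using that k p by (simp add: x_def tail_sign_def)
    ultimately show ?thesis by (simp add: lowest_def)
  qed
  ultimately show ?thesis by (intro bexI[of _ x]) auto
qed

lemma weight_chain_standard:
  "weight_chain q D (standard_module q D) (\<lambda>x. if x \<in> hvertices q D then lowest D p k x else 0) p (p - k)"
proof -
  let ?w = "\<lambda>x. if x \<in> hvertices q D then lowest D p k x else 0"
  have op: "site_op q D M ?w x = site_op q D M (lowest D p k) x" if "x \<in> hvertices q D" for M x
    using that by (intro site_op_cong) auto
  interpret hamming_module q D "standard_module q D"
    by (rule hamming_module_standard[OF q])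
  show ?thesis
  proof unfold_locales
    show "?w \<noteq> \<zero>\<^bsub>standard_module q D\<^esub>" using lowest_nonzero by (auto simp: fun_eq_iff)
    show "site_mat q D lower_loc \<odot>\<^bsub>standard_module q D\<^esub> ?w = \<zero>\<^bsub>standard_module q D\<^esub>"
      by (auto simp: site_mat_apply op lower_lowest intro!: ext)
    show "site_mat q D zero_loc \<odot>\<^bsub>standard_module q D\<^esub> ?w = cscale (hvertices q D) (standard_module q D) (of_nat (p - k)) ?w"
      using q by (auto simp: cscale_def site_mat_apply op site_op_zero zeros_lowest sum_scalar_cmat_left intro!: ext)
    show "site_mat q D (proj_loc q) \<odot>\<^bsub>standard_module q D\<^esub> ?w = cscale (hvertices q D) (standard_module q D) (of_nat p) ?w"
      by (auto simp: cscale_def site_mat_apply op proj_lowest sum_scalar_cmat_left intro!: ext)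
  qed auto
qed

end

text \<open>The module is generated by the lowest weight vector in a copy of the standard module;
  with \<open>z = p - k\<close> the parameter \<open>p - z\<close> becomes \<open>k\<close>.\<close>

lemma L_module_exists:
  assumes "q \<ge> 3" "(p, k) \<in> index_pairs D" "\<exists>f :: complex \<Rightarrow> 'v. inj f"
  shows "\<exists>V :: 'v tmodule. is_L_module q D p k V"
proof -
  have pk: "2 * k \<le> p" "p \<le> D" using assms(2) by (auto simp: index_pairs_def)
  obtain f :: "complex \<Rightarrow> 'v" where f: "inj f" using assms(3) by blast
  obtain g :: "((nat \<Rightarrow> nat) \<Rightarrow> complex) \<Rightarrow> complex"
    where g: "inj_on g {f. \<forall>x. x \<notin> hvertices q D \<longrightarrow> f x = 0}"
    using inj_finite_support[OF finite_hvertices] by blast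
  have "inj_on (f \<circ> g) (carrier (standard_module q D))"
    using g f by (intro comp_inj_on) (auto simp: standard_module_def intro: inj_on_subset)
  from lowest_weight_is_L_module[OF weight_chain_transport[OF weight_chain_standard[OF assms(1) pk] this]]
  show ?thesis using pk by auto
qed

section \<open>Isomorphisms and the spectrum of the dual adjacency matrix\<close>

locale module_basis = hamming_module +
  fixes n :: nat and v
  assumes basis: "is_basis (hvertices q D) V n v"
begin

definition lin :: "(nat \<Rightarrow> complex) \<Rightarrow> 'a" where
  "lin c = (\<Oplus>\<^bsub>V\<^esub>i\<in>{..<n}. c i \<cdot> v i)"

lemma v_closed: "i < n \<Longrightarrow> v i \<in> carrier V"
  using basis by (auto simp: is_basis_def)

lemma lin_closed [simp]: "lin c \<in> carrier V"
  unfolding lin_def by (intro M.finsum_closed) (auto simp: v_closed)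

lemma lin_cong: "(\<And>i. i < n \<Longrightarrow> c i = d i) \<Longrightarrow> lin c = lin d"
  unfolding lin_def by (intro M.finsum_cong') (auto simp: v_closed)

lemma lin_eq_iff: "lin c = lin d \<longleftrightarrow> (\<forall>i<n. c i = d i)"
proof
  assume eq: "lin c = lin d"
  have "\<exists>!e. e \<in> {..<n} \<rightarrow>\<^sub>E (UNIV :: complex set) \<and> lin c = lin e"
    using basis lin_closed[of c] by (simp add: is_basis_def flip: lin_def)
  \<comment> \<open>Uniqueness in \<open>is_basis\<close> holds among extensional families, hence
    the passage to restrictions.\<close>
  moreover have "lin c = lin (restrict c {..<n})" by (rule lin_cong) simp
  moreover have "lin c = lin (restrict d {..<n})" unfolding eq by (rule lin_cong) simp
  ultimately have "restrict c {..<n} = restrict d {..<n}"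
    by (metis (mono_tags, lifting) UNIV_I restrict_PiE_iff)
  then show "\<forall>i<n. c i = d i" by (metis lessThan_iff restrict_apply')
qed (auto intro: lin_cong)

lemma lin_exists:
  assumes "x \<in> carrier V"
  shows "\<exists>c. x = lin c"
  using basis assms unfolding is_basis_def lin_def by blast

lemma lin_add: "lin c \<oplus>\<^bsub>V\<^esub> lin d = lin (\<lambda>i. c i + d i)"
proof -
  have "lin (\<lambda>i. c i + d i) = (\<Oplus>\<^bsub>V\<^esub>i\<in>{..<n}. c i \<cdot> v i \<oplus>\<^bsub>V\<^esub> d i \<cdot> v i)"
    unfolding lin_def by (rule M.finsum_cong') (auto simp: cs_add_left v_closed)
  also have "\<dots> = lin c \<oplus>\<^bsub>V\<^esub> lin d"
    unfolding lin_def by (rule M.finsum_addf) (auto simp: v_closed)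
  finally show ?thesis by (rule sym)
qed

lemma cs_lin: "d \<cdot> lin c = lin (\<lambda>i. d * c i)"
proof -
  have "d \<cdot> lin c = (\<Oplus>\<^bsub>V\<^esub>i\<in>{..<n}. d \<cdot> c i \<cdot> v i)"
    unfolding lin_def cscale_def[of _ _ d] by (rule finsum_act) (auto simp: v_closed)
  also have "\<dots> = lin (\<lambda>i. d * c i)"
    unfolding lin_def by (intro M.finsum_cong') (auto simp: v_closed)
  finally show ?thesis .
qed

lemma lin_zero: "lin (\<lambda>_. 0) = \<zero>\<^bsub>V\<^esub>"
  using cs_lin[of 0 "\<lambda>_. 0"] by simp

lemma acts_by_lin:
  assumes "a \<in> carrier T" "acts_by (hvertices q D) V n v a B"
  shows "a \<odot>\<^bsub>V\<^esub> lin c = lin (\<lambda>i. \<Sum>j<n. B i j * c j)"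
proof -
  \<comment> \<open>The induction runs over partial sums of the argument, while \<open>lin\<close>
    always involves all \<open>n\<close> basis vectors.\<close>
  have "(\<Oplus>\<^bsub>V\<^esub>j\<in>{..<m}. a \<odot>\<^bsub>V\<^esub> (c j \<cdot> v j)) = lin (\<lambda>i. \<Sum>j<m. B i j * c j)" if "m \<le> n" for m
    using that
  proof (induction m)
    case 0
    then show ?case by (simp add: lin_zero)
  next
    case (Suc m)
    have "a \<odot>\<^bsub>V\<^esub> (c m \<cdot> v m) = c m \<cdot> (a \<odot>\<^bsub>V\<^esub> v m)"
      using Suc.prems assms by (simp add: smult_cs v_closed)
    also have "a \<odot>\<^bsub>V\<^esub> v m = lin (\<lambda>i. B i m)"
      using Suc.prems assms by (simp add: acts_by_def lin_def)
    finally have "a \<odot>\<^bsub>V\<^esub> (c m \<cdot> v m) = lin (\<lambda>i. B i m * c m)"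
      by (simp add: cs_lin mult.commute)
    then show ?case
      using Suc assms(1)
      by (simp add: lessThan_Suc M.finsum_insert Pi_iff smult_closed v_closed lin_add add.commute)
  qed
  from this[OF order_refl] show ?thesis
    unfolding lin_def[of c] using assms(1) by (subst finsum_act) (auto simp: v_closed)
qed

end

lemma module_basis_intro:
  assumes "left_module (terwilliger_algebra q D) V" "q \<ge> 3" "is_basis (hvertices q D) V n v"
  shows "module_basis q D V n v"
  using assms
  by (simp add: module_basis_def module_basis_axioms_def hamming_module_def hamming_module_axioms_def)

text \<open>Matching coordinates is bijective and additive. It intertwines the two generators
  because they act by the same matrices, and \<open>terwilliger_induct\<close> extends this to the
  algebra.\<close>

lemma basis_isomorphic:
  assumes V: "module_basis q D V n v"
      "acts_by (hvertices q D) V n v (adj_mat q D) A" "acts_by (hvertices q D) V n v (dual_adj_mat q D) B"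
    and W: "module_basis q D W n w"
      "acts_by (hvertices q D) W n w (adj_mat q D) A" "acts_by (hvertices q D) W n w (dual_adj_mat q D) B"
  shows "isomorphic_modules (terwilliger_algebra q D) V W"
proof -
  interpret V: module_basis q D V n v by fact
  interpret W: module_basis q D W n w by fact
  define h where "h x = W.lin (SOME c. x = V.lin c)" for x
  have h: "h (V.lin c) = W.lin c" for c
  proof -
    have "V.lin c = V.lin (SOME d. V.lin c = V.lin d)" by (rule someI[of "\<lambda>d. V.lin c = V.lin d", OF refl])
    then show ?thesis unfolding h_def V.lin_eq_iff by (intro W.lin_cong) simp
  qed
  have hc: "h x \<in> carrier W" for x by (simp add: h_def)
  have intertwines: "\<forall>x\<in>carrier V. h (a \<odot>\<^bsub>V\<^esub> x) = a \<odot>\<^bsub>W\<^esub> h x"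
    if "a \<in> carrier (terwilliger_algebra q D)" "acts_by (hvertices q D) V n v a C" "acts_by (hvertices q D) W n w a C"
    for a C
  proof
    fix x assume "x \<in> carrier V"
    then obtain c where "x = V.lin c" using V.lin_exists by blast
    then show "h (a \<odot>\<^bsub>V\<^esub> x) = a \<odot>\<^bsub>W\<^esub> h x"
      using that by (simp add: h V.acts_by_lin W.acts_by_lin)
  qed
  have "bij_betw h (carrier V) (carrier W)"
  proof (rule bij_betwI')
    show "h x = h y \<longleftrightarrow> x = y" if xy: "x \<in> carrier V" "y \<in> carrier V" for x y
    proof -
      obtain c d where "x = V.lin c" "y = V.lin d" using xy V.lin_exists by metis
      then show ?thesis by (simp add: h V.lin_eq_iff W.lin_eq_iff)
    qed
    show "h x \<in> carrier W" for x by (simp add: h_def)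
    show "\<exists>x\<in>carrier V. y = h x" if y: "y \<in> carrier W" for y
    proof -
      obtain c where "y = W.lin c" using y W.lin_exists by metis
      then show ?thesis by (intro bexI[of _ "V.lin c"]) (simp_all add: h)
    qed
  qed
  moreover have h_add: "h (x \<oplus>\<^bsub>V\<^esub> y) = h x \<oplus>\<^bsub>W\<^esub> h y" if xy: "x \<in> carrier V" "y \<in> carrier V" for x y
  proof -
    obtain c d where "x = V.lin c" "y = V.lin d" using xy V.lin_exists by metis
    then show ?thesis by (simp add: h V.lin_add W.lin_add)
  qed
  moreover have "\<forall>x\<in>carrier V. h (a \<odot>\<^bsub>V\<^esub> x) = a \<odot>\<^bsub>W\<^esub> h x" if "a \<in> carrier (terwilliger_algebra q D)" for a
    using that
  proof (induction a rule: terwilliger_induct)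
    case (scalar c)
    show ?case
    proof
      fix x assume "x \<in> carrier V"
      then obtain d where "x = V.lin d" using V.lin_exists by metis
      then show "h (scalar_cmat (hvertices q D) c \<odot>\<^bsub>V\<^esub> x) = scalar_cmat (hvertices q D) c \<odot>\<^bsub>W\<^esub> h x"
        using V.cs_lin[of c d] W.cs_lin[of c d] by (simp add: h cscale_def)
    qed
  next
    case adj
    show ?case by (rule intertwines[OF generators_in_terwilliger(1) V(2) W(2)])
  next
    case dual
    show ?case by (rule intertwines[OF generators_in_terwilliger(2) V(3) W(3)])
  next
    case (add a b)
    then show ?case
      by (simp add: V.smult_l_distr W.smult_l_distr V.smult_closed hc h_add)
  next
    case (mult a b)
    then show ?case
      by (simp add: V.smult_assoc W.smult_assoc V.smult_closed hc)
  qed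
  ultimately show ?thesis unfolding isomorphic_modules_def by blast
qed

section \<open>Isomorphism as an equivalence relation\<close>

lemma isomorphic_refl: "isomorphic_modules R V V"
  unfolding isomorphic_modules_def by (intro exI[of _ id]) auto

lemma isomorphic_trans:
  assumes "isomorphic_modules R U V" "isomorphic_modules R V W"
  shows "isomorphic_modules R U W"
proof -
  obtain f where f: "bij_betw f (carrier U) (carrier V)"
    "\<And>x y. x \<in> carrier U \<Longrightarrow> y \<in> carrier U \<Longrightarrow> f (x \<oplus>\<^bsub>U\<^esub> y) = f x \<oplus>\<^bsub>V\<^esub> f y"
    "\<And>a x. a \<in> carrier R \<Longrightarrow> x \<in> carrier U \<Longrightarrow> f (a \<odot>\<^bsub>U\<^esub> x) = a \<odot>\<^bsub>V\<^esub> f x"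
    using assms(1) unfolding isomorphic_modules_def by blast
  obtain g where g: "bij_betw g (carrier V) (carrier W)"
    "\<And>x y. x \<in> carrier V \<Longrightarrow> y \<in> carrier V \<Longrightarrow> g (x \<oplus>\<^bsub>V\<^esub> y) = g x \<oplus>\<^bsub>W\<^esub> g y"
    "\<And>a x. a \<in> carrier R \<Longrightarrow> x \<in> carrier V \<Longrightarrow> g (a \<odot>\<^bsub>V\<^esub> x) = a \<odot>\<^bsub>W\<^esub> g x"
    using assms(2) unfolding isomorphic_modules_def by blast
  have "f x \<in> carrier V" if "x \<in> carrier U" for x using f(1) that by (auto simp: bij_betw_def)
  then show ?thesis
    unfolding isomorphic_modules_def
    by (intro exI[of _ "g \<circ> f"]) (auto simp: f g intro: bij_betw_trans[OF f(1) g(1)])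
qed

lemma isomorphic_sym:
  assumes "isomorphic_modules R V W" "left_module R V"
  shows "isomorphic_modules R W V"
proof -
  interpret left_module R V by fact
  obtain f where f: "bij_betw f (carrier V) (carrier W)"
    "\<And>x y. x \<in> carrier V \<Longrightarrow> y \<in> carrier V \<Longrightarrow> f (x \<oplus>\<^bsub>V\<^esub> y) = f x \<oplus>\<^bsub>W\<^esub> f y"
    "\<And>a x. a \<in> carrier R \<Longrightarrow> x \<in> carrier V \<Longrightarrow> f (a \<odot>\<^bsub>V\<^esub> x) = a \<odot>\<^bsub>W\<^esub> f x"
    using assms(1) unfolding isomorphic_modules_def by blast
  define g where "g = inv_into (carrier V) f"
  have g: "bij_betw g (carrier W) (carrier V)" unfolding g_def by (rule bij_betw_inv_into[OF f(1)])
  have gf: "g (f x) = x" if "x \<in> carrier V" for x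
    using f(1) that by (simp add: g_def bij_betw_inv_into_left)
  have W: "\<exists>x\<in>carrier V. y = f x" if "y \<in> carrier W" for y
    using f(1) that by (auto simp: bij_betw_def)
  show ?thesis
    unfolding isomorphic_modules_def
  proof (intro exI[of _ g] conjI ballI g)
    fix x y assume "x \<in> carrier W" "y \<in> carrier W"
    then obtain x' y' where "x' \<in> carrier V" "y' \<in> carrier V" "x = f x'" "y = f y'" using W by metis
    then show "g (x \<oplus>\<^bsub>W\<^esub> y) = g x \<oplus>\<^bsub>V\<^esub> g y"
      by (simp add: gf f(2)[symmetric])
  next
    fix a x assume "a \<in> carrier R" "x \<in> carrier W"
    then obtain x' where "x' \<in> carrier V" "x = f x'" using W by metis
    then show "g (a \<odot>\<^bsub>W\<^esub> x) = a \<odot>\<^bsub>V\<^esub> g x"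
      using \<open>a \<in> carrier R\<close> by (simp add: gf smult_closed f(3)[symmetric])
  qed
qed

lemma iso_class_eq:
  assumes "left_module R V" "left_module R W"
  shows "iso_class R V = iso_class R W \<longleftrightarrow> isomorphic_modules R V W"
proof
  assume "iso_class R V = iso_class R W"
  moreover have "V \<in> iso_class R V" using assms by (simp add: iso_class_def isomorphic_refl)
  ultimately have "isomorphic_modules R W V" by (simp add: iso_class_def)
  then show "isomorphic_modules R V W" using isomorphic_sym assms by blast
next
  assume "isomorphic_modules R V W"
  then show "iso_class R V = iso_class R W"
    unfolding iso_class_def using isomorphic_trans isomorphic_sym assms by blast
qed

section \<open>The spectrum of \<open>A\<^sup>*\<close> as an invariant\<close>

definition dual_eigenvalues :: "nat \<Rightarrow> nat \<Rightarrow> 'v tmodule \<Rightarrow> complex set" where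
  "dual_eigenvalues q D V = {c. \<exists>x\<in>carrier V. x \<noteq> \<zero>\<^bsub>V\<^esub> \<and>
     dual_adj_mat q D \<odot>\<^bsub>V\<^esub> x = cscale (hvertices q D) V c x}"

lemma dual_eigenvalues_isomorphic:
  assumes "isomorphic_modules (terwilliger_algebra q D) V W"
    and "hamming_module q D V" "hamming_module q D W"
  shows "dual_eigenvalues q D V \<subseteq> dual_eigenvalues q D W"
proof
  interpret V: hamming_module q D V by fact
  interpret W: hamming_module q D W by fact
  obtain f where f: "bij_betw f (carrier V) (carrier W)"
    "\<And>a x. a \<in> carrier V.T \<Longrightarrow> x \<in> carrier V \<Longrightarrow> f (a \<odot>\<^bsub>V\<^esub> x) = a \<odot>\<^bsub>W\<^esub> f x"
    using assms(1) unfolding isomorphic_modules_def by blast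
  have fc: "f x \<in> carrier W" if "x \<in> carrier V" for x using f(1) that by (auto simp: bij_betw_def)
  \<comment> \<open>The zero vector is the zero matrix applied to it, and \<open>f\<close> commutes
    with the action of that matrix.\<close>
  have zero: "f \<zero>\<^bsub>V\<^esub> = \<zero>\<^bsub>W\<^esub>"
    using f(2)[of "\<zero>\<^bsub>V.T\<^esub>" "\<zero>\<^bsub>V\<^esub>"] fc by simp
  fix c assume "c \<in> dual_eigenvalues q D V"
  then obtain x where x: "x \<in> carrier V" "x \<noteq> \<zero>\<^bsub>V\<^esub>"
    and e: "dual_adj_mat q D \<odot>\<^bsub>V\<^esub> x = cscale (hvertices q D) V c x"
    by (auto simp: dual_eigenvalues_def)
  have "f x \<noteq> \<zero>\<^bsub>W\<^esub>"
    using f(1) x zero V.M.zero_closed by (metis bij_betw_def inj_onD)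
  moreover have "dual_adj_mat q D \<odot>\<^bsub>W\<^esub> f x = cscale (hvertices q D) W c (f x)"
    using arg_cong[OF e, of f] x by (simp add: f(2) cscale_def)
  ultimately show "c \<in> dual_eigenvalues q D W"
    using fc x by (auto simp: dual_eigenvalues_def)
qed

lemma is_L_moduleE:
  assumes "is_L_module q D p k V" "q \<ge> 3"
  obtains v where "module_basis q D V (p - 2 * k + 1) v"
    "acts_by (hvertices q D) V (p - 2 * k + 1) v (adj_mat q D) (L_tridiag q D p k)"
    "acts_by (hvertices q D) V (p - 2 * k + 1) v (dual_adj_mat q D) (L_diag q D p k)"
  using assms unfolding is_L_module_def irreducible_module_def
  by (metis module_basis_intro)

text \<open>In coordinates the eigenvalue equation is diagonal: a nonzero coordinate forces the
  eigenvalue to be the corresponding \<open>L_theta\<close>, and unit vectors realise each of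
  them.\<close>

lemma L_module_dual_eigenvalues:
  assumes "is_L_module q D p k V" "q \<ge> 3"
  shows "dual_eigenvalues q D V = L_theta q D p k ` {..<p - 2 * k + 1}"
proof -
  define n where "n = p - 2 * k + 1"
  obtain v where v: "module_basis q D V n v"
    "acts_by (hvertices q D) V n v (dual_adj_mat q D) (L_diag q D p k)"
    using is_L_moduleE[OF assms] unfolding n_def by metis
  interpret module_basis q D V n v by fact
  have act: "dual_adj_mat q D \<odot>\<^bsub>V\<^esub> lin c = lin (\<lambda>i. L_theta q D p k i * c i)" for c
  proof -
    have "lin (\<lambda>i. \<Sum>j<n. L_diag q D p k i j * c j) = lin (\<lambda>i. L_theta q D p k i * c i)"
      by (intro lin_cong) (simp add: L_diag_def if_distrib[of "\<lambda>x. x * _"] cong: if_cong)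
    then show ?thesis using acts_by_lin[OF _ v(2)] by simp
  qed
  have eig: "dual_adj_mat q D \<odot>\<^bsub>V\<^esub> lin c = e \<cdot> lin c \<longleftrightarrow> (\<forall>i<n. L_theta q D p k i * c i = e * c i)" for e c
    unfolding act cs_lin lin_eq_iff ..
  have nonzero: "lin c \<noteq> \<zero>\<^bsub>V\<^esub> \<longleftrightarrow> (\<exists>i<n. c i \<noteq> 0)" for c
    unfolding lin_zero[symmetric] lin_eq_iff by auto
  have "e \<in> dual_eigenvalues q D V \<longleftrightarrow> (\<exists>c. lin c \<noteq> \<zero>\<^bsub>V\<^esub> \<and> dual_adj_mat q D \<odot>\<^bsub>V\<^esub> lin c = e \<cdot> lin c)" for e
    unfolding dual_eigenvalues_def mem_Collect_eq using lin_exists lin_closed by metis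
  then have "e \<in> dual_eigenvalues q D V \<longleftrightarrow> (\<exists>c. (\<exists>i<n. c i \<noteq> 0) \<and> (\<forall>i<n. L_theta q D p k i * c i = e * c i))" for e
    unfolding eig nonzero .
  moreover have "(\<exists>c :: nat \<Rightarrow> complex. (\<exists>i<n. c i \<noteq> 0) \<and> (\<forall>i<n. L_theta q D p k i * c i = e * c i))
      \<longleftrightarrow> e \<in> L_theta q D p k ` {..<n}" for e
  proof
    assume "e \<in> L_theta q D p k ` {..<n}"
    then obtain i where "i < n" "e = L_theta q D p k i" by auto
    then show "\<exists>c :: nat \<Rightarrow> complex. (\<exists>i<n. c i \<noteq> 0) \<and> (\<forall>i<n. L_theta q D p k i * c i = e * c i)"
      by (intro exI[of _ "\<lambda>j. if j = i then 1 else 0"]) auto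
  qed auto
  ultimately show ?thesis unfolding n_def[symmetric] by blast
qed

text \<open>The substitution \<open>m = p - k - i\<close> shows that \<open>Z\<close> takes exactly
  the values from \<open>k\<close> to \<open>p - k\<close>; the end points of this interval will
  recover \<open>k\<close> and \<open>p\<close>.\<close>

lemma L_theta_image:
  assumes "(p, k) \<in> index_pairs D"
  shows "L_theta q D p k ` {..<p - 2 * k + 1} = (\<lambda>m. of_nat q * of_nat m - of_nat D) ` {k..p - k}"
proof -
  have k: "2 * k \<le> p" using assms by (auto simp: index_pairs_def)
  have theta: "L_theta q D p k i = of_nat q * of_nat (p - k - i) - of_nat D" if "i \<le> p - 2 * k" for i
    using that k by (simp add: L_theta_def of_nat_diff algebra_simps)
  have "(\<lambda>i. p - k - i) ` {..p - 2 * k} = {k..p - k}"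
  proof (intro equalityI subsetI)
    fix m assume "m \<in> {k..p - k}"
    then show "m \<in> (\<lambda>i. p - k - i) ` {..p - 2 * k}"
      using k by (intro image_eqI[of _ _ "p - k - m"]) auto
  qed (use k in auto)
  then have "(\<lambda>m. of_nat q * of_nat m - of_nat D :: complex) ` {k..p - k}
      = (\<lambda>m. of_nat q * of_nat m - of_nat D) ` (\<lambda>i. p - k - i) ` {..p - 2 * k}" by simp
  also have "\<dots> = (\<lambda>i. of_nat q * of_nat (p - k - i) - of_nat D) ` {..p - 2 * k}"
    by (rule image_image)
  also have "\<dots> = L_theta q D p k ` {..p - 2 * k}"
    by (intro image_cong) (auto simp: theta)
  finally show ?thesis by (simp add: lessThan_Suc_atMost)
qed

lemma L_module_isomorphic_imp_eq:
  assumes "is_L_module q D p k V" "is_L_module q D p' k' W" "q \<ge> 3"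
    "(p, k) \<in> index_pairs D" "(p', k') \<in> index_pairs D"
    "isomorphic_modules (terwilliger_algebra q D) V W"
  shows "p = p' \<and> k = k'"
proof -
  have ham: "hamming_module q D V" "hamming_module q D W"
    using assms by (auto simp: is_L_module_def irreducible_module_def hamming_module_def hamming_module_axioms_def)
  then have "isomorphic_modules (terwilliger_algebra q D) W V"
    by (intro isomorphic_sym[OF assms(6)]) (simp add: hamming_module_def)
  then have "dual_eigenvalues q D V = dual_eigenvalues q D W"
    using dual_eigenvalues_isomorphic[OF _ ham(2,1)] dual_eigenvalues_isomorphic[OF assms(6) ham]
    by (intro equalityI)
  then have "(\<lambda>m. of_nat q * of_nat m - of_nat D :: complex) ` {k..p - k}
      = (\<lambda>m. of_nat q * of_nat m - of_nat D) ` {k'..p' - k'}"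
    unfolding L_module_dual_eigenvalues[OF assms(1,3)] L_module_dual_eigenvalues[OF assms(2,3)]
      L_theta_image[OF assms(4)] L_theta_image[OF assms(5)] .
  moreover have "inj (\<lambda>m. of_nat q * of_nat m - of_nat D :: complex)"
    using assms(3) by (auto intro!: injI)
  ultimately have "{k..p - k} = {k'..p' - k'}" by (simp add: inj_image_eq_iff)
  \<comment> \<open>Both intervals are nonempty, so their equality yields equal end points.\<close>
  moreover have "k \<le> p - k" "k' \<le> p' - k'" using assms by (auto simp: index_pairs_def)
  ultimately have "k = k'" "p - k = p' - k'"
    unfolding Icc_eq_Icc by blast+
  then show ?thesis using \<open>k \<le> p - k\<close> \<open>k' \<le> p' - k'\<close> assms(4,5) by (auto simp: index_pairs_def)
qed

lemma L_modules_isomorphic: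
  assumes "is_L_module q D p k V" "is_L_module q D p k W" "q \<ge> 3"
  shows "isomorphic_modules (terwilliger_algebra q D) V W"
  by (rule is_L_moduleE[OF assms(1,3)], rule is_L_moduleE[OF assms(2,3)], rule basis_isomorphic)

text \<open>The assumption \<open>universe\<close> gives \<open>'v\<close> room for a copy of every
  \<open>L_{p,k}\<close>. The first conjunct justifies the choice in \<open>L_module\<close>, and
  the second makes its isomorphism class independent of that choice.\<close>

theorem theorem1p11:
  fixes q D :: nat
  assumes "q \<ge> 3" and "D \<ge> 1"
    and universe: "\<exists>f :: complex \<Rightarrow> 'v. inj f"
  shows
    "(\<forall>(p, k)\<in>index_pairs D. \<exists>V :: 'v tmodule. is_L_module q D p k V) \<and>
     (\<forall>(p, k)\<in>index_pairs D. \<forall>(V :: 'v tmodule) (W :: 'v tmodule).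
        is_L_module q D p k V \<longrightarrow> is_L_module q D p k W \<longrightarrow>
        isomorphic_modules (terwilliger_algebra q D) V W) \<and>
     bij_betw
       (\<lambda>(p, k). iso_class (terwilliger_algebra q D) (L_module q D p k :: 'v tmodule))
       (index_pairs D)
       (irreducible_classes (terwilliger_algebra q D))"
proof (intro conjI)
  let ?T = "terwilliger_algebra q D"
  let ?L = "\<lambda>p k. L_module q D p k :: 'v tmodule"
  have ex: "\<exists>V :: 'v tmodule. is_L_module q D p k V" if "(p, k) \<in> index_pairs D" for p k
    using L_module_exists assms that by blast
  then show "\<forall>(p, k)\<in>index_pairs D. \<exists>V :: 'v tmodule. is_L_module q D p k V" by blast
  show "\<forall>(p, k)\<in>index_pairs D. \<forall>(V :: 'v tmodule) (W :: 'v tmodule).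
        is_L_module q D p k V \<longrightarrow> is_L_module q D p k W \<longrightarrow> isomorphic_modules ?T V W"
    using L_modules_isomorphic assms(1) by blast
  have L: "is_L_module q D p k (?L p k)" if "(p, k) \<in> index_pairs D" for p k
    unfolding L_module_def by (rule someI_ex[OF ex[OF that]])
  have left: "left_module ?T V" if "is_L_module q D p k V" for p k and V :: "'v tmodule"
    using that by (simp add: is_L_module_def irreducible_module_def)
  show "bij_betw (\<lambda>(p, k). iso_class ?T (?L p k)) (index_pairs D) (irreducible_classes ?T)"
  proof (rule bij_betwI')
    fix a b assume ab: "a \<in> index_pairs D" "b \<in> index_pairs D"
    obtain p k p' k' where [simp]: "a = (p, k)" "b = (p', k')" by (cases a, cases b) auto
    show "((case a of (p, k) \<Rightarrow> iso_class ?T (?L p k)) = (case b of (p, k) \<Rightarrow> iso_class ?T (?L p k))) \<longleftrightarrow> a = b"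
      using L_module_isomorphic_imp_eq[OF L L assms(1), of p k p' k'] ab iso_class_eq[OF left[OF L] left[OF L], of p k p' k']
      by auto
  next
    fix a assume a: "a \<in> index_pairs D"
    then show "(case a of (p, k) \<Rightarrow> iso_class ?T (?L p k)) \<in> irreducible_classes ?T"
      using L by (cases a) (auto simp: irreducible_classes_def is_L_module_def)
  next
    fix C :: "'v tmodule set" assume "C \<in> irreducible_classes ?T"
    then obtain V :: "'v tmodule" where V: "irreducible_module ?T V" "C = iso_class ?T V"
      by (auto simp: irreducible_classes_def)
    obtain p k where pk: "(p, k) \<in> index_pairs D" "is_L_module q D p k V"
      by (rule irreducible_is_L_module[OF V(1) assms(1)])
    have "C = iso_class ?T (?L p k)"
      unfolding V(2) iso_class_eq[OF left[OF pk(2)] left[OF L[OF pk(1)]]]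
      by (rule L_modules_isomorphic[OF pk(2) L[OF pk(1)] assms(1)])
    then show "\<exists>a\<in>index_pairs D. C = (case a of (p, k) \<Rightarrow> iso_class ?T (?L p k))"
      using pk(1) by (intro bexI[of _ "(p, k)"]) auto
  qed
qed

end
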